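(* Let $d>1$, $a_1,\dots,a_n,b_1,\dots,b_n$ be integers as described in the context, and for every algebraically closed field $K$ let $V\subset K^{n+2}$ be the associated simplicial toric variety. Suppose that the following conditions hold. (A) There are indices $i,j\in\{1,\dots,n\}$ such that $a_i=0$, $b_i\neq 0$, $a_j\neq 0$, $b_j=0$. (B) For all $i=1,\dots,n$: (i) $d\mid a_i\Leftrightarrow d\mid b_i$; (ii) $d\nmid a_i\Leftrightarrow \gcd(d,a_i)=1$, and $d\nmid b_i\Leftrightarrow\gcd(d,b_i)=1$. (C) In the matrix of residue classes modulo $d$ $$\begin{pmatrix}\bar a_1&\bar a_2&\cdots&\bar a_n\\ \bar b_1&\bar b_2&\cdots&\bar b_n\end{pmatrix}$$ the rows are proportional, i.e., one of them is an integer multiple of the other. (D) There is an index $i$ such that $\gcd(d,a_i)=1$. If $d$ has two distinct prime divisors, then $\operatorname{ara}V=3$ in all characteristics, i.e., $V$ is not a set-theoretic complete intersection over any algebraically closed field $K$.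
   Context: Setting: $n$ is a positive integer, $d$ is a positive integer, and $a_1,\dots,a_n,b_1,\dots,b_n$ are nonnegative integers such that for every index $i$ at least one of $a_i,b_i$ is nonzero, and $\gcd(d,a_1,\dots,a_n,b_1,\dots,b_n)=1$. For an algebraically closed field $K$, the variety $V\subset K^{n+2}$ (coordinates $x_1,\dots,x_n,y_1,y_2$) is the set of all points $$x_i=u_i^d\ (i=1,\dots,n),\qquad y_1=u_1^{a_1}u_2^{a_2}\cdots u_n^{a_n},\qquad y_2=u_1^{b_1}u_2^{b_2}\cdots u_n^{b_n},\qquad (u_1,\dots,u_n)\in K^n.$$ It has codimension 2. The arithmetical rank $\operatorname{ara}V$ of an affine variety $V\subset K^N$ is the minimum number of polynomial equations (over $K$, in $N$ variables) whose common zero set in $K^N$ is $V$. One has $\operatorname{ara}V\ge\operatorname{codim}V$, and $V$ is called a set-theoretic complete intersection if equality holds (here: if $\operatorname{ara}V=2$). *)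

theory Defs
  imports
    "HOL-Analysis.Analysis"
    "HOL-Library.Poly_Mapping"
    "HOL-Number_Theory.Cong"
    "HOL-Computational_Algebra.Computational_Algebra"
begin

text \<open>
  Polynomials over \<open>'k\<close> in variables indexed by \<open>'v\<close> are finitely supported maps from exponent
  vectors to coefficients. With the convolution product of \<^theory>\<open>HOL-Library.Poly_Mapping\<close> they
  form the usual polynomial ring. A finite type \<open>'v\<close> gives the affine space \<open>'k ^ 'v\<close>.
\<close>

type_synonym ('v, 'k) mpoly = "('v \<Rightarrow>\<^sub>0 nat) \<Rightarrow>\<^sub>0 'k"

definition mpoly_eval :: "('v::finite, 'k::comm_ring_1) mpoly \<Rightarrow> 'k ^ 'v \<Rightarrow> 'k" where
  "mpoly_eval p z =
     (\<Sum>m\<in>Poly_Mapping.keys p.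
        Poly_Mapping.lookup p m * (\<Prod>v\<in>UNIV. (z $ v) ^ Poly_Mapping.lookup m v))"

definition zero_locus :: "('v::finite, 'k::comm_ring_1) mpoly set \<Rightarrow> ('k ^ 'v) set" where
  "zero_locus F = {z. \<forall>p\<in>F. mpoly_eval p z = 0}"

text \<open>
  The value is \<open>\<infinity>\<close> if the set is not cut out by finitely many equations; otherwise
  the infimum is attained.
\<close>

definition ara :: "('k::comm_ring_1 ^ 'v::finite) set \<Rightarrow> enat" where
  "ara V = (INF F\<in>{F. finite F \<and> zero_locus F = V}. enat (card F))"

definition zariski_closed :: "('k::comm_ring_1 ^ 'v::finite) set \<Rightarrow> bool" where
  "zariski_closed Z \<longleftrightarrow> (\<exists>F. Z = zero_locus F)"

definition irreducible_closed :: "('k::comm_ring_1 ^ 'v::finite) set \<Rightarrow> bool" where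
  "irreducible_closed Z \<longleftrightarrow> zariski_closed Z \<and> Z \<noteq> {} \<and>
     (\<forall>A B. zariski_closed A \<and> zariski_closed B \<and> Z = A \<union> B \<longrightarrow> Z = A \<or> Z = B)"

definition krull_dim :: "('k::comm_ring_1 ^ 'v::finite) set \<Rightarrow> enat" where
  "krull_dim V = (SUP r\<in>{r. \<exists>Z :: nat \<Rightarrow> ('k ^ 'v) set.
     (\<forall>i\<le>r. irreducible_closed (Z i) \<and> Z i \<subseteq> V) \<and> (\<forall>i<r. Z i \<subset> Z (Suc i))}. enat r)"

definition codim :: "('k::comm_ring_1 ^ 'v::finite) set \<Rightarrow> enat" where
  "codim V = enat CARD('v) - krull_dim V"

definition set_theoretic_complete_intersection ::
    "('k::comm_ring_1 ^ 'v::finite) set \<Rightarrow> bool" where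
  "set_theoretic_complete_intersection V \<longleftrightarrow> ara V = codim V"

text \<open>
  The coordinates are indexed by \<open>'n + 2\<close>: \<open>x\<^sub>i\<close> has index \<open>Inl i\<close>, and \<open>y\<^sub>1\<close>, \<open>y\<^sub>2\<close> have indices
  \<open>Inr 1\<close>, \<open>Inr 2\<close>. In the type \<open>2\<close>, the numerals \<open>1\<close> and \<open>2\<close> denote the two distinct elements.
\<close>

definition toric_param ::
    "nat \<Rightarrow> ('n::finite \<Rightarrow> nat) \<Rightarrow> ('n \<Rightarrow> nat) \<Rightarrow> 'k::comm_ring_1 ^ 'n \<Rightarrow> 'k ^ ('n + 2)" where
  "toric_param d a b u = (\<chi> c. case c of
       Inl i \<Rightarrow> (u $ i) ^ d
     | Inr j \<Rightarrow> if j = 1 then (\<Prod>i\<in>UNIV. (u $ i) ^ a i) else (\<Prod>i\<in>UNIV. (u $ i) ^ b i))"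

definition toric_variety ::
    "nat \<Rightarrow> ('n::finite \<Rightarrow> nat) \<Rightarrow> ('n \<Rightarrow> nat) \<Rightarrow> ('k::comm_ring_1 ^ ('n + 2)) set" where
  "toric_variety d a b = range (toric_param d a b)"

end

theory Submission
  imports Defs
begin

text \<open>
  Slice \<open>V\<close> by \<open>x\<^sub>m = 1\<close> for \<open>m \<noteq> i, j\<close>, where \<open>i, j\<close> are as in (A). The slice is a finite union of
  surfaces \<open>y\<^sub>1 = \<omega> x\<^sub>j\<^sup>\<alpha>, y\<^sub>2 = \<theta> x\<^sub>i\<^sup>\<beta>\<close> in affine 4-space with \<open>\<omega>, \<theta>\<close> roots of unity, and \<open>\<omega> = 1\<close> iff
  \<open>\<theta> = 1\<close> since the rows are proportional. As one of the two primes differs from the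
  characteristic, there is a surface with \<open>\<omega> \<noteq> 1\<close>, and it meets the surface \<open>\<omega> = \<theta> = 1\<close> only at the
  origin. By Hartshorne's connectedness theorem such a union is not cut out by two equations.
  In the other direction, \<open>y\<^sub>1\<^sup>d = x\<^sup>a\<close>, \<open>y\<^sub>2\<^sup>d = x\<^sup>b\<close> and one binomial relation between \<open>y\<^sub>1\<^sup>k\<close> and \<open>y\<^sub>2\<close>,
  with \<open>b \<equiv> k a\<close> modulo \<open>d\<close>, define \<open>V\<close>.
\<close>

section \<open>The Nullstellensatz\<close>

text \<open>Hartshorne's argument is carried out globally. The function that is 0 on the surface of
  \<open>(1, 1)\<close> and 1 on the others is a fraction with a power of \<open>s\<close> below,
  and also one with a power of \<open>t\<close> below; they agree modulo \<open>(f, g)\<close>.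
  Regularity of \<open>s, t\<close> modulo \<open>(f, g)\<close> turns them into one polynomial.
  Along the curves \<open>z = t = 0\<close> of two surfaces, which meet at the origin, its values
  there would be both zero and nonzero. The obstacle is that regularity. It is obtained in the
  reverse order: \<open>f, g\<close> stay regular after setting \<open>s = 0\<close> and after
  setting \<open>s = t = 0\<close>, since the reduced ideal contains a power of \<open>y\<close> and
  an element prime to \<open>y\<close>. The Nullstellensatz supplies these elements, but only up to
  powers since \<open>(f, g)\<close> may fail to be radical; hence the common exponent
  \<open>M\<close>. Iterated univariate polynomials serve both ends: setting \<open>s = 0\<close> is
  taking the coefficient of index 0, and the Nullstellensatz is an induction on the number of
  variables. The dimension of \<open>V\<close> enters only through codimension at most 2, which a
  chain of coordinate faces provides.\<close>

definition is_ring_hom :: "('a::comm_ring_1 \<Rightarrow> 'b::comm_ring_1) \<Rightarrow> bool" where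
  "is_ring_hom \<phi> \<longleftrightarrow> \<phi> 1 = 1 \<and> (\<forall>x y. \<phi> (x + y) = \<phi> x + \<phi> y) \<and> (\<forall>x y. \<phi> (x * y) = \<phi> x * \<phi> y)"

lemma is_ring_homD:
  assumes "is_ring_hom \<phi>"
  shows "\<phi> 1 = 1" "\<phi> (x + y) = \<phi> x + \<phi> y" "\<phi> (x * y) = \<phi> x * \<phi> y" "\<phi> 0 = 0"
    "\<phi> (- x) = - \<phi> x" "\<phi> (x - y) = \<phi> x - \<phi> y" "\<phi> (x ^ n) = \<phi> x ^ n"
proof -
  show 1: "\<phi> 1 = 1" and add: "\<phi> (x + y) = \<phi> x + \<phi> y" and mult: "\<phi> (x * y) = \<phi> x * \<phi> y" for x y
    using assms by (auto simp: is_ring_hom_def)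
  show 0: "\<phi> 0 = 0" using add[of 0 0] by simp
  show neg: "\<phi> (- x) = - \<phi> x" for x
    using add[of x "- x"] 0 by (simp add: add_eq_0_iff)
  show "\<phi> (x - y) = \<phi> x - \<phi> y" using add[of x "- y"] neg by simp
  show "\<phi> (x ^ n) = \<phi> x ^ n" by (induction n) (auto simp: 1 mult)
qed

lemma is_ring_hom_sum: "is_ring_hom \<phi> \<Longrightarrow> \<phi> (\<Sum>i\<in>I. f i) = (\<Sum>i\<in>I. \<phi> (f i))"
  by (induction I rule: infinite_finite_induct) (auto simp: is_ring_homD)

lemma is_ring_hom_prod: "is_ring_hom \<phi> \<Longrightarrow> \<phi> (\<Prod>i\<in>I. f i) = (\<Prod>i\<in>I. \<phi> (f i))"
  by (induction I rule: infinite_finite_induct) (auto simp: is_ring_homD)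

text \<open>If \<open>\<phi>\<close> is a point of the base ring, this is the point of the
  polynomial ring above it with new coordinate \<open>x\<close>. Iteration from the identity of the
  field gives the points of affine space.\<close>

definition hom_extend :: "('a::comm_ring_1 \<Rightarrow> 'b::comm_ring_1) \<Rightarrow> 'b \<Rightarrow> 'a poly \<Rightarrow> 'b" where
  "hom_extend \<phi> x p = poly (map_poly \<phi> p) x"

lemma hom_extend_pCons:
  "is_ring_hom \<phi> \<Longrightarrow> hom_extend \<phi> x (pCons c p) = \<phi> c + x * hom_extend \<phi> x p"
  by (simp add: hom_extend_def map_poly_pCons is_ring_homD)

lemma hom_extend_0 [simp]: "hom_extend \<phi> x 0 = 0"
  by (simp add: hom_extend_def)

lemma is_ring_hom_extend:
  assumes \<phi>: "is_ring_hom \<phi>"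
  shows "is_ring_hom (hom_extend \<phi> x)"
proof -
  have add: "hom_extend \<phi> x (p + q) = hom_extend \<phi> x p + hom_extend \<phi> x q" for p q
    by (induction p q rule: poly_induct2) (simp_all add: hom_extend_pCons[OF \<phi>] is_ring_homD[OF \<phi>] algebra_simps)
  have smult: "hom_extend \<phi> x (smult c p) = \<phi> c * hom_extend \<phi> x p" for c p
    by (induction p) (simp_all add: hom_extend_pCons[OF \<phi>] is_ring_homD[OF \<phi>] algebra_simps)
  have mult: "hom_extend \<phi> x (p * q) = hom_extend \<phi> x p * hom_extend \<phi> x q" for p q
    by (induction p) (simp_all add: add smult hom_extend_pCons[OF \<phi>] is_ring_homD[OF \<phi>] algebra_simps)
  have "hom_extend \<phi> x 1 = 1"
    unfolding one_pCons by (simp add: hom_extend_pCons[OF \<phi>] is_ring_homD[OF \<phi>])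
  with add mult show ?thesis by (simp add: is_ring_hom_def)
qed

section \<open>Ideals and prime ideals\<close>

definition is_ideal :: "'a::comm_ring_1 set \<Rightarrow> bool" where
  "is_ideal J \<longleftrightarrow> 0 \<in> J \<and> (\<forall>x\<in>J. \<forall>y\<in>J. x + y \<in> J) \<and> (\<forall>x\<in>J. \<forall>r. r * x \<in> J)"

lemma is_idealD:
  assumes "is_ideal J"
  shows "0 \<in> J" "x \<in> J \<Longrightarrow> y \<in> J \<Longrightarrow> x + y \<in> J" "x \<in> J \<Longrightarrow> r * x \<in> J" "x \<in> J \<Longrightarrow> x * r \<in> J"
    "x \<in> J \<Longrightarrow> y \<in> J \<Longrightarrow> x - y \<in> J" "x \<in> J \<Longrightarrow> - x \<in> J"
proof -
  show "0 \<in> J" and a: "x \<in> J \<Longrightarrow> y \<in> J \<Longrightarrow> x + y \<in> J" and m: "x \<in> J \<Longrightarrow> r * x \<in> J" for x y r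
    using assms by (auto simp: is_ideal_def)
  show "x \<in> J \<Longrightarrow> x * r \<in> J" using m[of x r] by (simp add: mult.commute)
  show n: "x \<in> J \<Longrightarrow> - x \<in> J" for x using m[of x "-1"] by simp
  show "x \<in> J \<Longrightarrow> y \<in> J \<Longrightarrow> x - y \<in> J" using a[of x "- y"] n[of y] by simp
qed

lemma is_ideal_sum: "is_ideal J \<Longrightarrow> (\<And>i. i \<in> A \<Longrightarrow> f i \<in> J) \<Longrightarrow> (\<Sum>i\<in>A. f i) \<in> J"
  by (induction A rule: infinite_finite_induct) (auto intro: is_idealD)

definition is_prime_ideal :: "'a::comm_ring_1 set \<Rightarrow> bool" where
  "is_prime_ideal P \<longleftrightarrow> is_ideal P \<and> 1 \<notin> P \<and> (\<forall>x y. x * y \<in> P \<longrightarrow> x \<in> P \<or> y \<in> P)"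

lemma is_prime_ideal_power:
  assumes "is_prime_ideal P" "x ^ n \<in> P"
  shows "x \<in> P"
  using assms(2)
proof (induction n)
  case 0
  then show ?case using assms(1) by (simp add: is_prime_ideal_def)
next
  case (Suc n)
  then show ?case using assms(1) by (auto simp: is_prime_ideal_def)
qed

lemma is_ideal_adjoin:
  assumes J: "is_ideal J"
  shows "is_ideal {j + r * x |j r. j \<in> J}" (is "is_ideal ?A")
  unfolding is_ideal_def
proof (intro conjI ballI allI)
  show "0 \<in> ?A" using is_idealD(1)[OF J] by (metis (mono_tags, lifting) add_0 mem_Collect_eq mult_zero_left)
next
  fix a b assume "a \<in> ?A" "b \<in> ?A"
  then obtain j r j' r' where *: "a = j + r * x" "j \<in> J" "b = j' + r' * x" "j' \<in> J" by blast
  then have "a + b = (j + j') + (r + r') * x" by (simp add: algebra_simps)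
  then show "a + b \<in> ?A" using * is_idealD(2)[OF J] by blast
next
  fix a c assume "a \<in> ?A"
  then obtain j r where *: "a = j + r * x" "j \<in> J" by blast
  then have "c * a = c * j + (c * r) * x" by (simp add: algebra_simps)
  then show "c * a \<in> ?A" using * is_idealD(3)[OF J] by blast
qed

lemma ideal_adjoin_superset:
  assumes J: "is_ideal J"
  shows "J \<subseteq> {j + r * x |j r. j \<in> J}" "x \<in> {j + r * x |j r. j \<in> J}"
proof -
  have "j = j + 0 * x" for j by simp
  then show "J \<subseteq> {j + r * x |j r. j \<in> J}" by blast
  have "x = 0 + 1 * x" by simp
  then show "x \<in> {j + r * x |j r. j \<in> J}" using is_idealD(1)[OF J] by blast
qed

text \<open>By Zorn there is an ideal over \<open>J\<close> that is maximal among those without a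
  power of \<open>h\<close>. It is prime: adjoining \<open>x\<close> or \<open>y\<close> from
  outside captures a power of \<open>h\<close>, and multiplying the two expressions puts a power of
  \<open>h\<close> into the ideal if \<open>x * y\<close> lies in it.\<close>

lemma exists_prime_ideal_avoiding_powers:
  assumes J: "is_ideal J" and h: "\<And>n. h ^ n \<notin> J"
  obtains P where "is_prime_ideal P" "J \<subseteq> P" "h \<notin> P"
proof -
  define \<A> where "\<A> = {I. is_ideal I \<and> J \<subseteq> I \<and> (\<forall>n. h ^ n \<notin> I)}"
  have "\<exists>M\<in>\<A>. \<forall>X\<in>\<A>. M \<subseteq> X \<longrightarrow> X = M"
  proof (rule subset_Zorn_nonempty)
    show "\<A> \<noteq> {}" using J h by (auto simp: \<A>_def)
  next
    fix C assume C: "C \<noteq> {}" "subset.chain \<A> C"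
    then have C': "\<And>I. I \<in> C \<Longrightarrow> I \<in> \<A>" by (auto simp: subset_chain_def)
    have tot: "X \<subseteq> Y \<or> Y \<subseteq> X" if "X \<in> C" "Y \<in> C" for X Y
      using C(2) that by (auto simp: subset_chain_def)
    have "is_ideal (\<Union>C)"
      unfolding is_ideal_def
    proof (intro conjI ballI allI)
      show "0 \<in> \<Union>C" using C(1) C' by (auto simp: \<A>_def is_ideal_def)
    next
      fix x y assume "x \<in> \<Union>C" "y \<in> \<Union>C"
      then obtain X Y where "X \<in> C" "x \<in> X" "Y \<in> C" "y \<in> Y" by blast
      with tot[of X Y] obtain Z where "Z \<in> C" "x \<in> Z" "y \<in> Z" by blast
      with C'[of Z] show "x + y \<in> \<Union>C" by (auto simp: \<A>_def is_ideal_def)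
    next
      fix x r assume "x \<in> \<Union>C"
      with C' show "r * x \<in> \<Union>C" by (fastforce simp: \<A>_def is_ideal_def)
    qed
    moreover have "J \<subseteq> \<Union>C" using C(1) C' by (auto simp: \<A>_def)
    ultimately show "\<Union>C \<in> \<A>" using C' by (auto simp: \<A>_def)
  qed
  then obtain P where P: "P \<in> \<A>" and max: "\<And>X. X \<in> \<A> \<Longrightarrow> P \<subseteq> X \<Longrightarrow> X = P" by blast
  have idP: "is_ideal P" and JP: "J \<subseteq> P" and hP: "\<And>n. h ^ n \<notin> P" using P by (auto simp: \<A>_def)
  have adj: "\<exists>n j r. h ^ n = j + r * x \<and> j \<in> P" if "x \<notin> P" for x
  proof (rule ccontr)
    assume neg: "\<not> ?thesis"
    let ?A = "{j + r * x |j r. j \<in> P}"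
    have sub: "P \<subseteq> ?A" by (rule ideal_adjoin_superset[OF idP])
    have "?A \<in> \<A>"
      using is_ideal_adjoin[OF idP] sub JP neg unfolding \<A>_def by blast
    then have "?A = P" using max sub by blast
    moreover have "x \<in> ?A" by (rule ideal_adjoin_superset[OF idP])
    ultimately show False using that by blast
  qed
  have "x \<in> P \<or> y \<in> P" if "x * y \<in> P" for x y
  proof (rule ccontr)
    assume "\<not> ?thesis"
    then obtain n j r m i q where 1: "h ^ n = j + r * x" "j \<in> P" "h ^ m = i + q * y" "i \<in> P"
      using adj by metis
    have "h ^ (n + m) = j * h ^ m + (r * x) * i + (r * q) * (x * y)"
      unfolding power_add 1 by (simp add: algebra_simps)
    also have "\<dots> \<in> P" by (intro is_idealD(2)[OF idP] is_idealD(3,4)[OF idP] 1 that)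
    finally show False using hP by blast
  qed
  moreover have "1 \<notin> P" using hP[of 0] by simp
  moreover have "h \<notin> P" using hP[of 1] by simp
  ultimately show ?thesis using that idP JP by (auto simp: is_prime_ideal_def)
qed

lemma infinite_UNIV_alg_closed: "infinite (UNIV :: 'k::alg_closed_field set)"
proof
  assume fin: "finite (UNIV :: 'k set)"
  define p :: "'k poly" where "p = (\<Prod>a\<in>UNIV. [:- a, 1:]) + 1"
  have "degree (\<Prod>a\<in>(UNIV::'k set). [:- a, 1:]) = card (UNIV :: 'k set)"
    by (subst degree_prod_eq_sum_degree) auto
  moreover have "card (UNIV :: 'k set) > 0" using fin by (simp add: card_gt_0_iff)
  ultimately have "degree p > 0"
    unfolding p_def by (subst degree_add_eq_left) auto
  then obtain x where "poly p x = 0" using alg_closed_imp_poly_has_root by blast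
  moreover have "poly p x = 1"
    using fin by (auto simp: p_def poly_prod)
  ultimately show False by simp
qed

lemma poly_nonroot:
  fixes p :: "'k::alg_closed_field poly"
  assumes "p \<noteq> 0"
  obtains x where "poly p x \<noteq> 0"
  using poly_roots_finite[OF assms] infinite_UNIV_alg_closed by (metis (full_types) UNIV_eq_I mem_Collect_eq)

text \<open>Below degree \<open>m\<close> every leading coefficient lies in \<open>C\<close>, so the
  leading term lies in \<open>J\<close> and can be subtracted; induction on the degree. Below
  \<open>m\<close>, elements of \<open>J\<close> are thus zero modulo \<open>C\<close>.\<close>

lemma coeffs_in_ideal_of_minimal_degree:
  fixes J :: "'a::comm_ring_1 poly set"
  assumes J: "is_ideal J" and C: "is_ideal C" "\<And>c. c \<in> C \<Longrightarrow> [:c:] \<in> J"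
    and min: "\<And>p. p \<in> J \<Longrightarrow> lead_coeff p \<notin> C \<Longrightarrow> m \<le> degree p"
    and "r \<in> J" "r = 0 \<or> degree r < m"
  shows "coeff r i \<in> C"
  using assms(5,6)
proof (induction "degree r" arbitrary: r rule: less_induct)
  case less
  have lc: "lead_coeff r \<in> C"
    using min[OF less.prems(1)] less.prems(2) is_idealD(1)[OF C(1)] by force
  show ?case
  proof (cases "degree r = 0")
    case True
    then obtain c where "r = [:c:]" using degree_eq_zeroE by blast
    then show ?thesis using lc is_idealD(1)[OF C(1)] by (auto simp: coeff_pCons split: nat.splits)
  next
    case False
    define r' where "r' = r - monom (lead_coeff r) (degree r)"
    have "monom (lead_coeff r) (degree r) = monom 1 (degree r) * [:lead_coeff r:]"
      by (simp add: smult_monom)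
    then have "r' \<in> J"
      unfolding r'_def using less.prems(1) C(2)[OF lc] is_idealD(3,5)[OF J] by metis
    moreover have deg: "degree r' < degree r \<or> r' = 0"
    proof -
      have "degree r' \<le> degree r" unfolding r'_def
        by (intro degree_diff_le) (auto simp: degree_monom_le)
      moreover have "coeff r' (degree r) = 0" by (simp add: r'_def)
      ultimately show ?thesis by (metis le_neq_implies_less leading_coeff_0_iff)
    qed
    ultimately have "coeff r' i \<in> C"
      using less.hyps[of r'] less.prems(2) is_idealD(1)[OF C(1)] by (cases "r' = 0") auto
    moreover have "coeff r i = coeff r' i + (if i = degree r then lead_coeff r else 0)"
      by (auto simp: r'_def)
    ultimately show ?thesis using lc by (auto intro!: is_idealD[OF C(1)])
  qed
qed

text \<open>The polynomial ring over a field is treated as an iterated univariate ring; its points are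
  the homomorphisms in \<open>\<Phi>\<close>.\<close>

definition nullstellensatz_property :: "('a::comm_ring_1 \<Rightarrow> 'k::field) set \<Rightarrow> bool" where
  "nullstellensatz_property \<Phi> \<longleftrightarrow> (\<forall>\<phi>\<in>\<Phi>. is_ring_hom \<phi>) \<and>
     (\<forall>P h. is_prime_ideal P \<and> h \<notin> P \<longrightarrow> (\<exists>\<phi>\<in>\<Phi>. (\<forall>p\<in>P. \<phi> p = 0) \<and> \<phi> h \<noteq> 0))"

lemma nullstellensatz_propertyD:
  assumes "nullstellensatz_property \<Phi>" "is_prime_ideal P" "h \<notin> P"
  shows "\<exists>\<phi>\<in>\<Phi>. (\<forall>p\<in>P. \<phi> p = 0) \<and> \<phi> h \<noteq> 0"
  using assms by (simp add: nullstellensatz_property_def)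

lemma nullstellensatz_property_field: "nullstellensatz_property {\<lambda>x::'k::field. x}"
proof -
  have "x = 0" if "is_prime_ideal P" "x \<in> P" for P :: "'k set" and x
  proof (rule ccontr)
    assume "x \<noteq> 0"
    then have "1 = inverse x * x" by simp
    then show False using that by (metis is_prime_ideal_def is_ideal_def)
  qed
  moreover have "h \<noteq> 0" if "is_prime_ideal P" "h \<notin> P" for P :: "'k set" and h
    using that by (metis is_prime_ideal_def is_ideal_def)
  ultimately show ?thesis unfolding nullstellensatz_property_def is_ring_hom_def by (simp add: Ball_def) blast
qed

lemma hom_extend_eq_0:
  assumes "\<And>i. \<phi> (coeff p i) = 0"
  shows "hom_extend \<phi> x p = 0"
proof -
  have "map_poly \<phi> p = 0"
  proof (rule poly_eqI)
    fix i
    have "\<phi> 0 = 0" using assms[of "Suc (degree p)"] by (simp add: coeff_eq_0)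
    then show "coeff (map_poly \<phi> p) i = coeff 0 i" by (simp add: coeff_map_poly assms)
  qed
  then show ?thesis by (simp add: hom_extend_def)
qed

lemma hom_extend_const: "is_ring_hom \<phi> \<Longrightarrow> hom_extend \<phi> x [:c:] = \<phi> c"
  by (simp add: hom_extend_pCons)

lemma hom_extend_smult: "is_ring_hom \<phi> \<Longrightarrow> hom_extend \<phi> x (smult c p) = \<phi> c * hom_extend \<phi> x p"
  using is_ring_homD(3)[OF is_ring_hom_extend, of \<phi> x "[:c:]" p] by (simp add: hom_extend_const)

text \<open>Let \<open>C\<close> be the contraction of \<open>P\<close>. If \<open>P\<close>
  consists of polynomials over \<open>C\<close>, a point that keeps a coefficient of
  \<open>h\<close> nonzero and a non-root of the image of \<open>h\<close> suffice. Otherwise an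
  \<open>f \<in> P\<close> of least degree modulo \<open>C\<close> generates \<open>P\<close> up to
  powers of its leading coefficient, and the new coordinate is a root of the image of
  \<open>f\<close>. Carrying a nonvanishing \<open>h\<close> through the induction is what allows
  the leading coefficient to be kept nonzero.\<close>

lemma nullstellensatz_property_poly:
  fixes \<Phi> :: "('a::idom \<Rightarrow> 'k::alg_closed_field) set"
  assumes NS: "nullstellensatz_property \<Phi>"
  shows "nullstellensatz_property {hom_extend \<phi> x |\<phi> x. \<phi> \<in> \<Phi>}"
proof -
  have hom: "is_ring_hom \<phi>" if "\<phi> \<in> \<Phi>" for \<phi>
    using NS that by (auto simp: nullstellensatz_property_def)
  have "\<exists>\<phi>\<in>\<Phi>. \<exists>x. (\<forall>p\<in>P. hom_extend \<phi> x p = 0) \<and> hom_extend \<phi> x h \<noteq> 0"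
    if P: "is_prime_ideal P" and h: "h \<notin> P" for P h
  proof -
    define C where "C = {c. [:c:] \<in> P}"
    have idP: "is_ideal P" and prP: "\<And>x y. x * y \<in> P \<Longrightarrow> x \<in> P \<or> y \<in> P"
      using P by (auto simp: is_prime_ideal_def)
    have prC: "is_prime_ideal C"
      unfolding is_prime_ideal_def is_ideal_def
    proof (intro conjI ballI allI impI)
      show "0 \<in> C" using is_idealD(1)[OF idP] by (simp add: C_def)
      show "1 \<notin> C" using P by (simp add: C_def is_prime_ideal_def one_pCons)
    next
      fix x y assume "x \<in> C" "y \<in> C"
      then show "x + y \<in> C" using is_idealD(2)[OF idP, of "[:x:]" "[:y:]"] by (simp add: C_def)
    next
      fix x r assume "x \<in> C"
      then show "r * x \<in> C" using is_idealD(3)[OF idP, of "[:x:]" "[:r:]"] by (simp add: C_def mult.commute)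
    next
      fix x y assume "x * y \<in> C"
      then show "x \<in> C \<or> y \<in> C" using prP[of "[:x:]" "[:y:]"] by (simp add: C_def mult.commute)
    qed
    then have idC: "is_ideal C" and prC': "\<And>x y. x * y \<in> C \<Longrightarrow> x \<in> C \<or> y \<in> C"
      by (auto simp: is_prime_ideal_def)
    have NSC: "\<exists>\<phi>\<in>\<Phi>. (\<forall>c\<in>C. \<phi> c = 0) \<and> \<phi> e \<noteq> 0" if "e \<notin> C" for e
      using NS prC that unfolding nullstellensatz_property_def by blast
    have all_coeffs: "p \<in> P" if "\<And>i. coeff p i \<in> C" for p
    proof -
      have "(\<Sum>i\<le>degree p. [:coeff p i:] * monom 1 i) \<in> P"
        by (rule is_ideal_sum[OF idP], rule is_idealD(4)[OF idP]) (use that in \<open>simp add: C_def\<close>)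
      then show ?thesis by (simp add: smult_monom poly_as_sum_of_monoms)
    qed
    show ?thesis
    proof (cases "\<exists>p\<in>P. lead_coeff p \<notin> C")
      case False
      \<comment> \<open>No leading coefficient lies outside \<open>C\<close> here, so the minimality
        premise is vacuous and \<open>m\<close> may be chosen just above the degree of
        \<open>p\<close>.\<close>
      have coeffs: "coeff p i \<in> C" if "p \<in> P" for p i
        by (rule coeffs_in_ideal_of_minimal_degree[OF idP idC, where m = "Suc (degree p)"])
          (use False that in \<open>auto simp: C_def\<close>)
      obtain j where "coeff h j \<notin> C" using all_coeffs h by blast
      then obtain \<phi> where \<phi>: "\<phi> \<in> \<Phi>" "\<And>c. c \<in> C \<Longrightarrow> \<phi> c = 0" "\<phi> (coeff h j) \<noteq> 0"
        using NSC by blast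
      have "coeff (map_poly \<phi> h) j \<noteq> 0"
        using \<phi>(3) is_ring_homD(4)[OF hom[OF \<phi>(1)]] by (simp add: coeff_map_poly)
      then have "map_poly \<phi> h \<noteq> 0" by auto
      then obtain x where "poly (map_poly \<phi> h) x \<noteq> 0" using poly_nonroot by blast
      then have "hom_extend \<phi> x h \<noteq> 0" by (simp add: hom_extend_def)
      then show ?thesis using \<phi>(1) hom_extend_eq_0[of \<phi>] coeffs \<phi>(2) by blast
    next
      case True
      define m where "m = (LEAST m. \<exists>p\<in>P. lead_coeff p \<notin> C \<and> degree p = m)"
      obtain f where f: "f \<in> P" "lead_coeff f \<notin> C" "degree f = m"
        using LeastI_ex[of "\<lambda>m. \<exists>p\<in>P. lead_coeff p \<notin> C \<and> degree p = m"] True unfolding m_def by blast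
      have min: "m \<le> degree p" if "p \<in> P" "lead_coeff p \<notin> C" for p
        unfolding m_def by (rule Least_le) (use that in blast)
      have "m > 0"
      proof (rule ccontr)
        assume "\<not> m > 0"
        then obtain c where "f = [:c:]" using f(3) degree_eq_zeroE by blast
        then show False using f by (simp add: C_def)
      qed
      have f0: "f \<noteq> 0" using f(2) is_idealD(1)[OF idC] by auto
      have low: "coeff r i \<in> C" if "r \<in> P" "r = 0 \<or> degree r < m" for r i
        by (rule coeffs_in_ideal_of_minimal_degree[OF idP idC _ min that]) (auto simp: C_def)
      text \<open>A form of the resultant: \<open>f\<close> is irreducible modulo \<open>P \<inter> 'a\<close>, so \<open>f\<close> and \<open>h\<close> generate
        a nonzero constant.\<close>
      have "\<exists>c. c \<notin> C \<and> (\<exists>j\<in>P. \<exists>q. [:c:] = j + q * h)"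
      proof -
        define J where "J = {j + q * h |j q. j \<in> P}"
        have idJ: "is_ideal J" unfolding J_def by (rule is_ideal_adjoin[OF idP])
        have PJ: "P \<subseteq> J" unfolding J_def by (rule ideal_adjoin_superset[OF idP])
        have hJ: "h \<in> J" unfolding J_def by (rule ideal_adjoin_superset[OF idP])
        define k where "k = (LEAST k. \<exists>p\<in>J. lead_coeff p \<notin> C \<and> degree p = k)"
        obtain w where w: "w \<in> J" "lead_coeff w \<notin> C" "degree w = k"
          using LeastI_ex[of "\<lambda>m. \<exists>p\<in>J. lead_coeff p \<notin> C \<and> degree p = m"] f PJ unfolding k_def by blast
        have mink: "k \<le> degree p" if "p \<in> J" "lead_coeff p \<notin> C" for p
          unfolding k_def by (rule Least_le) (use that in blast)
        have lowk: "coeff r i \<in> C" if "r \<in> J" "r = 0 \<or> degree r < k" for r i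
          by (rule coeffs_in_ideal_of_minimal_degree[OF idJ idC _ mink that]) (use PJ in \<open>auto simp: C_def\<close>)
        have w0: "w \<noteq> 0" using w(2) is_idealD(1)[OF idC] by auto
        have div: "\<exists>e q r. e \<notin> C \<and> smult e p = w * q + r \<and> r \<in> P \<and> (\<forall>i. coeff r i \<in> C)" if "p \<in> J" for p
        proof -
          obtain q r where qr: "pseudo_divmod p w = (q, r)" by fastforce
          define e where "e = coeff w (degree w) ^ (Suc (degree p) - degree w)"
          have eq: "smult e p = w * q + r" and deg: "r = 0 \<or> degree r < k"
            using pseudo_divmod[OF w0 qr] w(3) by (auto simp: e_def)
          have "r = [:e:] * p - w * q" using eq by simp
          also have "\<dots> \<in> J" by (intro is_idealD(3,4,5)[OF idJ] that w(1))
          finally have "coeff r i \<in> C" for i using lowk deg by blast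
          moreover have "e \<notin> C" unfolding e_def using is_prime_ideal_power[OF prC] w(2) by blast
          ultimately show ?thesis using eq all_coeffs by blast
        qed
        \<comment> \<open>If \<open>k > 0\<close>, dividing \<open>f\<close> by \<open>w\<close>
          leaves a remainder in \<open>P\<close>, so \<open>w * q \<in> P\<close>. Then
          \<open>w \<in> P\<close> would force \<open>h \<in> P\<close>, and
          \<open>q \<in> P\<close> contradicts a degree count modulo \<open>C\<close>.\<close>
        have "k = 0"
        proof (rule ccontr)
          assume k: "k \<noteq> 0"
          obtain e q r where d: "e \<notin> C" "smult e f = w * q + r" "r \<in> P" "\<forall>i. coeff r i \<in> C"
            using div f(1) PJ by blast
          have "w * q = [:e:] * f - r" using d(2) by simp
          also have "\<dots> \<in> P" by (intro is_idealD[OF idP] d f)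
          finally have "w \<in> P \<or> q \<in> P" by (rule prP)
          then show False
          proof
            assume wP: "w \<in> P"
            obtain e q r where d: "e \<notin> C" "smult e h = w * q + r" "r \<in> P"
              using div hJ by blast
            have "[:e:] * h \<in> P" using d wP by (auto intro!: is_idealD[OF idP])
            then have "[:e:] \<in> P \<or> h \<in> P" by (rule prP)
            then show False using h d(1) by (simp add: C_def)
          next
            assume qP: "q \<in> P"
            have eqC: "coeff (w * q) i - e * coeff f i \<in> C" for i
            proof -
              have "coeff (w * q) i - e * coeff f i = - coeff r i"
                using arg_cong[OF d(2), of "\<lambda>p. coeff p i"] by simp
              then show ?thesis using d(4) is_idealD(6)[OF idC] by simp
            qed
            \<comment> \<open>Degrees are taken modulo \<open>C\<close>: \<open>q\<close> has degree
              \<open>t\<close>, and \<open>q \<in> P\<close> gives \<open>t \<ge> m\<close>. So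
              \<open>w * q\<close> has degree \<open>k + t > m\<close>, while \<open>e * f\<close>
              has degree \<open>m\<close>.\<close>
            define B where "B = {i. coeff q i \<notin> C}"
            have "B \<subseteq> {..degree q}"
              using is_idealD(1)[OF idC] by (auto simp: B_def intro: le_degree)
            then have finB: "finite B" using finite_subset by blast
            have "B \<noteq> {}"
            proof
              assume "B = {}"
              then have "coeff q i \<in> C" for i by (auto simp: B_def)
              then have "coeff (w * q) m \<in> C"
                unfolding coeff_mult by (intro is_ideal_sum[OF idC] is_idealD(3)[OF idC])
              then have "e * coeff f m \<in> C" using is_idealD(5)[OF idC _ eqC[of m], of "coeff (w * q) m"] by simp
              then show False using prC' d(1) f by auto
            qed
            define t where "t = Max B"
            have t: "coeff q t \<notin> C" and above: "\<And>i. i > t \<Longrightarrow> coeff q i \<in> C"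
              using Max_in[OF finB \<open>B \<noteq> {}\<close>] Max_ge[OF finB] by (auto simp: t_def B_def not_less[symmetric])
            \<comment> \<open>The coefficients of \<open>q\<close> above \<open>t\<close> lie in
              \<open>C\<close>; removing them stays in \<open>P\<close> and makes \<open>t\<close>
              the true degree, so that minimality of \<open>m\<close> applies. The cutoff bound is
              exclusive, hence \<open>Suc t\<close>.\<close>
            define q' where "q' = poly_cutoff (Suc t) q"
            have "q - q' \<in> P"
              using above is_idealD(1)[OF idC] by (intro all_coeffs) (auto simp: q'_def coeff_poly_cutoff)
            then have q'P: "q' \<in> P" using is_idealD(5)[OF idP qP, of "q - q'"] by simp
            have "degree q' \<le> t" by (intro degree_le) (auto simp: q'_def coeff_poly_cutoff)
            moreover have cq': "coeff q' t = coeff q t" by (simp add: q'_def coeff_poly_cutoff)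
            ultimately have "degree q' = t" using t is_idealD(1)[OF idC] le_degree[of q' t] by force
            then have "m \<le> t" using min[OF q'P] cq' t by simp
            then have "coeff f (k + t) = 0" using k f(3) by (intro coeff_eq_0) simp
            then have "coeff (w * q) (k + t) \<in> C" using eqC[of "k + t"] by simp
            moreover have "coeff (w * q) (k + t) = coeff w k * coeff q t
                + (\<Sum>i\<in>{..k + t} - {k}. coeff w i * coeff q (k + t - i))"
              unfolding coeff_mult by (subst sum.remove[of _ k]) auto
            moreover have "coeff w i * coeff q (k + t - i) \<in> C" if "i \<in> {..k + t} - {k}" for i
            proof (cases "i < k")
              case True
              then show ?thesis by (intro is_idealD(3)[OF idC] above) simp
            next
              case False
              then have "coeff w i = 0" using that w(3) by (intro coeff_eq_0) auto
              then show ?thesis using is_idealD(1)[OF idC] by simp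
            qed
            then have "(\<Sum>i\<in>{..k + t} - {k}. coeff w i * coeff q (k + t - i)) \<in> C"
              by (rule is_ideal_sum[OF idC])
            ultimately have "coeff w k * coeff q t \<in> C"
              using is_idealD(5)[OF idC] by (metis add_diff_cancel_right')
            then show False using prC' t w by blast
          qed
        qed
        then obtain c where "w = [:c:]" using w(3) degree_eq_zeroE by blast
        then show ?thesis using w unfolding J_def by auto
      qed
      then obtain c j q where c: "c \<notin> C" "j \<in> P" "[:c:] = j + q * h" by blast
      \<comment> \<open>The factor \<open>lead_coeff f\<close> keeps the image of \<open>f\<close>
        at degree \<open>m > 0\<close>, so it has a root; the factor \<open>c\<close> keeps
        \<open>h\<close> nonzero at that root.\<close>
      have "c * lead_coeff f \<notin> C" using prC'[of c "lead_coeff f"] c(1) f(2) by argo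
      from NSC[OF this] obtain \<phi>
        where \<phi>: "\<phi> \<in> \<Phi>" "\<And>c. c \<in> C \<Longrightarrow> \<phi> c = 0" "\<phi> (c * lead_coeff f) \<noteq> 0"
        by auto
      note h\<phi> = is_ring_homD[OF hom[OF \<phi>(1)]]
      have nz: "\<phi> c \<noteq> 0" "\<phi> (lead_coeff f) \<noteq> 0" using \<phi>(3) unfolding h\<phi>(3) by auto
      have "degree (map_poly \<phi> f) = m" using nz(2) f(3) by (simp add: map_poly_degree_eq h\<phi>)
      then obtain x where "poly (map_poly \<phi> f) x = 0"
        using \<open>m > 0\<close> alg_closed_imp_poly_has_root by blast
      then have fx: "hom_extend \<phi> x f = 0" by (simp add: hom_extend_def)
      note hx = is_ring_homD[OF is_ring_hom_extend[OF hom[OF \<phi>(1)], of x]]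
      \<comment> \<open>Up to a power of the leading coefficient, \<open>p\<close> is a multiple of
        \<open>f\<close> plus a remainder with coefficients in \<open>C\<close>, and both
        vanish.\<close>
      have vanish: "hom_extend \<phi> x p = 0" if "p \<in> P" for p
      proof -
        obtain q r where qr: "pseudo_divmod p f = (q, r)" by fastforce
        define e where "e = coeff f (degree f) ^ (Suc (degree p) - degree f)"
        have eq: "smult e p = f * q + r" and deg: "r = 0 \<or> degree r < m"
          using pseudo_divmod[OF f0 qr] f(3) by (auto simp: e_def)
        have "r = [:e:] * p - f * q" using eq by simp
        also have "\<dots> \<in> P" by (intro is_idealD(3,4,5)[OF idP] that f(1))
        finally have "hom_extend \<phi> x r = 0" using hom_extend_eq_0[of \<phi>] low deg \<phi>(2) by blast
        then have "hom_extend \<phi> x (smult e p) = 0" unfolding eq by (simp add: hx fx)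
        then have "\<phi> e * hom_extend \<phi> x p = 0" by (simp add: hom_extend_smult[OF hom[OF \<phi>(1)]])
        moreover have "\<phi> e \<noteq> 0" using nz(2) by (simp add: e_def h\<phi>)
        ultimately show ?thesis by simp
      qed
      have "hom_extend \<phi> x [:c:] = hom_extend \<phi> x q * hom_extend \<phi> x h"
        unfolding c(3) by (simp add: hx vanish[OF c(2)])
      then have "hom_extend \<phi> x h \<noteq> 0" using nz(1) by (auto simp: hom_extend_const[OF hom[OF \<phi>(1)]])
      then show ?thesis using \<phi>(1) vanish by blast
    qed
  qed
  then show ?thesis
    unfolding nullstellensatz_property_def using is_ring_hom_extend hom by fastforce
qed

section \<open>Ideals with two generators\<close>

definition ideal2 :: "'a::comm_ring_1 \<Rightarrow> 'a \<Rightarrow> 'a set" where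
  "ideal2 f g = {x * f + y * g |x y. True}"

lemma ideal2_iff: "z \<in> ideal2 f g \<longleftrightarrow> (\<exists>x y. z = x * f + y * g)"
  by (simp add: ideal2_def)

lemma is_ideal_ideal2: "is_ideal (ideal2 f g)"
  unfolding is_ideal_def
proof (intro conjI ballI allI)
  show "0 \<in> ideal2 f g" unfolding ideal2_iff by (intro exI[of _ 0]) simp
next
  fix a b assume "a \<in> ideal2 f g" "b \<in> ideal2 f g"
  then obtain x y x' y' where "a = x * f + y * g" "b = x' * f + y' * g" by (auto simp: ideal2_iff)
  then have "a + b = (x + x') * f + (y + y') * g" by (simp add: algebra_simps)
  then show "a + b \<in> ideal2 f g" unfolding ideal2_iff by blast
next
  fix a r assume "a \<in> ideal2 f g"
  then obtain x y where "a = x * f + y * g" by (auto simp: ideal2_iff)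
  then have "r * a = (r * x) * f + (r * y) * g" by (simp add: algebra_simps)
  then show "r * a \<in> ideal2 f g" unfolding ideal2_iff by blast
qed

lemma ideal2_gens: "f \<in> ideal2 f g" "g \<in> ideal2 f g"
proof -
  have "f = 1 * f + 0 * g" "g = 0 * f + 1 * g" by simp_all
  then show "f \<in> ideal2 f g" "g \<in> ideal2 f g" unfolding ideal2_iff by blast+
qed

lemma hom_ideal2:
  assumes "is_ring_hom \<pi>" "z \<in> ideal2 f g"
  shows "\<pi> z \<in> ideal2 (\<pi> f) (\<pi> g)"
  using assms(2) is_ring_homD[OF assms(1)] unfolding ideal2_iff by metis

text \<open>The ideal \<open>(f, g)\<close> annihilates the first Koszul homology of
  \<open>f, g\<close>: for \<open>r = x * f + y * g\<close> the multiple by \<open>r\<close> of a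
  syzygy is the trivial one with factor \<open>y * a - x * b\<close>. As \<open>p, q\<close> is a
  regular sequence in the ideal, comparing the factors for \<open>p\<close> and \<open>q\<close>
  allows division by \<open>p\<close>.\<close>

lemma koszul_syzygy:
  fixes f g a b p q :: "'a::idom"
  assumes syz: "a * f + b * g = 0" and pq: "p \<in> ideal2 f g" "q \<in> ideal2 f g" and "p \<noteq> 0"
    and nzd: "\<And>c. p dvd c * q \<Longrightarrow> p dvd c"
  obtains e where "a = g * e" "b = - (f * e)"
proof -
  have transfer: "\<exists>c. a * r = g * c \<and> b * r = - (f * c)" if r_in: "r \<in> ideal2 f g" for r
  proof -
    obtain x y where r: "r = x * f + y * g" using r_in by (auto simp: ideal2_iff)
    have bg: "b * g = - (a * f)" and af: "a * f = - (b * g)" using syz by (simp_all add: add_eq_0_iff)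
    have "a * r = x * (a * f) + y * g * a" unfolding r by (simp add: algebra_simps)
    also have "\<dots> = g * (y * a - x * b)" unfolding af by (simp add: algebra_simps)
    finally have 1: "a * r = g * (y * a - x * b)" .
    have "b * r = x * f * b + y * (b * g)" unfolding r by (simp add: algebra_simps)
    also have "\<dots> = - (f * (y * a - x * b))" unfolding bg by (simp add: algebra_simps)
    finally show ?thesis using 1 by blast
  qed
  obtain c where c: "a * p = g * c" "b * p = - (f * c)" using transfer pq(1) by blast
  obtain c' where c': "a * q = g * c'" "b * q = - (f * c')" using transfer pq(2) by blast
  \<comment> \<open>Both sides equal \<open>a * p * q\<close> in the first equation and
    \<open>- (b * p * q)\<close> in the second.\<close>
  have "g * (c * q) = g * (c' * p)" "f * (c * q) = f * (c' * p)"
    using c c' by (metis mult.assoc mult.commute, metis minus_equation_iff mult.assoc mult.commute mult_minus_left)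
  moreover have "f \<noteq> 0 \<or> g \<noteq> 0" using pq(1) \<open>p \<noteq> 0\<close> by (auto simp: ideal2_iff)
  ultimately have "c * q = c' * p" by auto
  then have "p dvd c" using nzd by simp
  then obtain e where e: "c = p * e" by blast
  have "a * p = (g * e) * p" "b * p = (- (f * e)) * p" using c e by (simp_all add: algebra_simps)
  then show ?thesis using that \<open>p \<noteq> 0\<close> by (metis mult_right_cancel)
qed

text \<open>Here \<open>\<pi>\<close> is the reduction modulo \<open>J + (x)\<close>. Moving \<open>x\<close> behind \<open>f, g\<close> in a regular sequence
  needs no local or graded hypothesis, unlike arbitrary permutations.\<close>

lemma nonzerodivisor_mod_ideal2:
  fixes \<pi> :: "'r::comm_ring_1 \<Rightarrow> 's::comm_ring_1"
  assumes \<pi>: "is_ring_hom \<pi>" "surj \<pi>" and J: "is_ideal J"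
    and ker: "\<pi> x = 0" "\<And>j. j \<in> J \<Longrightarrow> \<pi> j = 0" "\<And>r. \<pi> r = 0 \<Longrightarrow> \<exists>r'. r - x * r' \<in> J"
    and nz: "\<And>r. x * r \<in> J \<Longrightarrow> r \<in> J"
    and syz: "\<And>a b. a * \<pi> f + b * \<pi> g = 0 \<Longrightarrow> \<exists>e. a = \<pi> g * e \<and> b = - (\<pi> f * e)"
    and h: "x * h - i \<in> J" "i \<in> ideal2 f g"
  shows "\<exists>i\<in>ideal2 f g. h - i \<in> J"
proof -
  note hom = is_ring_homD[OF \<pi>(1)]
  note idJ = is_idealD[OF J]
  obtain A B where i: "i = A * f + B * g" using h(2) by (auto simp: ideal2_iff)
  have "\<pi> x * \<pi> h - (\<pi> A * \<pi> f + \<pi> B * \<pi> g) = 0"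
    using ker(2)[OF h(1)] unfolding i hom .
  then have "\<pi> A * \<pi> f + \<pi> B * \<pi> g = 0"
    unfolding ker(1) by (simp only: mult_zero_left diff_0 neg_equal_0_iff_equal)
  \<comment> \<open>Modulo \<open>x\<close> the pair \<open>A, B\<close> is a syzygy, hence trivial.
    Subtracting a lift of that trivial syzygy does not change \<open>A * f + B * g\<close> and makes
    both coefficients multiples of \<open>x\<close> modulo \<open>J\<close>, so \<open>x\<close>
    cancels.\<close>
  then obtain e where e: "\<pi> A = \<pi> g * e" "\<pi> B = - (\<pi> f * e)" using syz by blast
  obtain e' where e': "e = \<pi> e'" using \<pi>(2) by blast
  have "\<pi> (A - g * e') = 0" "\<pi> (B + f * e') = 0" using e e' by (simp_all add: hom)
  then obtain A' B' where AB: "A - g * e' - x * A' \<in> J" "B + f * e' - x * B' \<in> J" using ker(3) by meson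
  have "x * (h - (A' * f + B' * g)) = (x * h - i) + (A - g * e' - x * A') * f + (B + f * e' - x * B') * g"
    by (simp add: i algebra_simps)
  also have "\<dots> \<in> J" by (intro idJ h AB)
  finally have "h - (A' * f + B' * g) \<in> J" by (rule nz)
  moreover have "A' * f + B' * g \<in> ideal2 f g" unfolding ideal2_iff by blast
  ultimately show ?thesis by blast
qed

lemma coeff_0_mult: "coeff (p * q) 0 = coeff p 0 * coeff q 0"
  by (simp add: coeff_mult)

lemma is_ring_hom_coeff_0: "is_ring_hom (\<lambda>p :: 'a::comm_ring_1 poly. coeff p 0)"
  by (simp add: is_ring_hom_def coeff_0_mult)

lemma is_ring_hom_coeff_0_0: "is_ring_hom (\<lambda>p :: 'a::comm_ring_1 poly poly. coeff (coeff p 0) 0)"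
  by (simp add: is_ring_hom_def coeff_0_mult)

lemma coeff_0_eq_0_iff:
  fixes p :: "'a::comm_ring_1 poly"
  shows "coeff p 0 = 0 \<longleftrightarrow> (\<exists>q. p = [:0, 1:] * q)"
proof
  assume "coeff p 0 = 0"
  then obtain q where "p = pCons 0 q" by (cases p) auto
  then have "p = [:0, 1:] * q" by simp
  then show "\<exists>q. p = [:0, 1:] * q" by blast
qed (auto simp: coeff_0_mult)

lemma is_ideal_principal: "is_ideal {x * q |q. True}"
  unfolding is_ideal_def
proof (intro conjI ballI allI)
  show "0 \<in> {x * q |q. True}" by (auto intro: exI[of _ 0])
next
  fix a b assume "a \<in> {x * q |q. True}" "b \<in> {x * q |q. True}"
  then show "a + b \<in> {x * q |q. True}" by (auto simp: distrib_left[symmetric])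
next
  fix a r assume "a \<in> {x * q |q. True}"
  then show "r * a \<in> {x * q |q. True}" by (auto simp: mult.left_commute[of r])
qed

text \<open>The case \<open>x = t\<close>, \<open>J = (s)\<close>, with \<open>s\<close> the outer
  variable and \<open>t\<close> the next one, of moving an element behind \<open>f, g\<close>: it
  makes \<open>t\<close> a nonzerodivisor modulo \<open>(s, f, g)\<close>.\<close>

lemma t_nonzerodivisor:
  fixes f g :: "'a::idom poly poly"
  assumes syz: "\<And>a b. a * coeff (coeff f 0) 0 + b * coeff (coeff g 0) 0 = 0 \<Longrightarrow>
      \<exists>e. a = coeff (coeff g 0) 0 * e \<and> b = - (coeff (coeff f 0) 0 * e)"
    and h: "[:[:0, 1:]:] * h - [:0, 1:] * y \<in> ideal2 f g"
  shows "\<exists>y'. h - [:0, 1:] * y' \<in> ideal2 f g"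
proof -
  let ?J = "{[:0, 1:] * q |q :: 'a poly poly. True}"
  have J: "r \<in> ?J \<longleftrightarrow> coeff r 0 = 0" for r :: "'a poly poly"
    using coeff_0_eq_0_iff[of r] by auto
  have "\<exists>i\<in>ideal2 f g. h - i \<in> ?J"
  proof (rule nonzerodivisor_mod_ideal2[OF is_ring_hom_coeff_0_0 _ is_ideal_principal _ _ _ _ syz])
    show "surj (\<lambda>p :: 'a poly poly. coeff (coeff p 0) 0)"
      by (rule surjI[of _ "\<lambda>c. [:[:c:]:]"]) simp
    show "\<exists>r'. r - [:[:0, 1:]:] * r' \<in> ?J" if "coeff (coeff r 0) 0 = 0" for r :: "'a poly poly"
    proof -
      obtain c where "coeff r 0 = [:0, 1:] * c" using \<open>coeff (coeff r 0) 0 = 0\<close> coeff_0_eq_0_iff by metis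
      then have "coeff (r - [:[:0, 1:]:] * [:c:]) 0 = 0" by simp
      then show ?thesis unfolding J by blast
    qed
    show "r \<in> ?J" if "[:[:0, 1:]:] * r \<in> ?J" for r :: "'a poly poly"
      using that unfolding J by (simp add: coeff_0_mult)
    show "[:[:0, 1:]:] * h - ([:[:0, 1:]:] * h - [:0, 1:] * y) \<in> ?J" by auto
  qed (use h in \<open>auto simp: coeff_0_mult\<close>)
  then obtain i y' where i: "i \<in> ideal2 f g" "h - i = [:0, 1:] * y'" by auto
  then have "h - [:0, 1:] * y' = i" by (simp add: algebra_simps)
  then show ?thesis using i(1) by metis
qed

text \<open>The same with \<open>x = s\<close> and \<open>J = 0\<close>.\<close>

lemma s_nonzerodivisor:
  fixes f g :: "'a::idom poly"
  assumes syz: "\<And>a b. a * coeff f 0 + b * coeff g 0 = 0 \<Longrightarrow>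
      \<exists>e. a = coeff g 0 * e \<and> b = - (coeff f 0 * e)"
    and h: "[:0, 1:] * h \<in> ideal2 f g"
  shows "h \<in> ideal2 f g"
proof -
  have "\<exists>i\<in>ideal2 f g. h - i \<in> {0}"
  proof (rule nonzerodivisor_mod_ideal2[OF is_ring_hom_coeff_0 _ _ _ _ _ _ syz])
    show "surj (\<lambda>p :: 'a poly. coeff p 0)"
      by (rule surjI[of _ "\<lambda>c. [:c:]"]) simp
    show "\<exists>r'. r - [:0, 1:] * r' \<in> {0}" if "coeff r 0 = 0" for r :: "'a poly"
      using that coeff_0_eq_0_iff[of r] by auto
    show "[:0, 1:] * h - [:0, 1:] * h \<in> {0}" by simp
  qed (use h in \<open>auto simp: is_ideal_def\<close>)
  then show ?thesis by auto
qed

text \<open>The gluing step: the premise says that the fractions \<open>x / s^n\<close> and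
  \<open>y / t^m\<close> agree modulo \<open>(f, g)\<close>, and \<open>h\<close> is a polynomial
  representing them. One factor \<open>s\<close> is split off \<open>x\<close> at a time, because
  \<open>t\<close> is regular modulo \<open>(s, f, g)\<close>.\<close>

lemma divide_power_mod_ideal2:
  fixes f g :: "'a::idom poly poly"
  assumes syz1: "\<And>a b. a * coeff f 0 + b * coeff g 0 = 0 \<Longrightarrow>
      \<exists>e. a = coeff g 0 * e \<and> b = - (coeff f 0 * e)"
    and syz2: "\<And>a b. a * coeff (coeff f 0) 0 + b * coeff (coeff g 0) 0 = 0 \<Longrightarrow>
      \<exists>e. a = coeff (coeff g 0) 0 * e \<and> b = - (coeff (coeff f 0) 0 * e)"
    and "[:[:0, 1:]:] ^ m * x - [:0, 1:] ^ n * y \<in> ideal2 f g"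
  shows "\<exists>h. x - [:0, 1:] ^ n * h \<in> ideal2 f g"
  using assms(3)
proof (induction n arbitrary: x)
  case 0
  show ?case using is_idealD(1)[OF is_ideal_ideal2] by (intro exI[of _ x]) simp
next
  case (Suc n)
  note id = is_idealD[OF is_ideal_ideal2[of f g]]
  have strip: "\<exists>z. x - [:0, 1:] * z \<in> ideal2 f g"
    if "[:[:0, 1:]:] ^ m * x - [:0, 1:] * y \<in> ideal2 f g" for m x y
    using that
  proof (induction m arbitrary: y)
    case 0
    then show ?case by auto
  next
    case (Suc m)
    then have "[:[:0, 1:]:] * ([:[:0, 1:]:] ^ m * x) - [:0, 1:] * y \<in> ideal2 f g"
      by (simp only: power_Suc mult.assoc)
    then have "\<exists>y'. [:[:0, 1:]:] ^ m * x - [:0, 1:] * y' \<in> ideal2 f g"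
      by (rule t_nonzerodivisor[rotated]) (erule syz2)
    then show ?case using Suc.IH by blast
  qed
  have "[:[:0, 1:]:] ^ m * x - [:0, 1:] * ([:0, 1:] ^ n * y) \<in> ideal2 f g"
    using Suc.prems by (simp only: power_Suc mult.assoc)
  then obtain z where z: "x - [:0, 1:] * z \<in> ideal2 f g" using strip by blast
  \<comment> \<open>After replacing \<open>x\<close> by \<open>s * z\<close> the whole relation is
    divisible by \<open>s\<close>, which cancels modulo \<open>(f, g)\<close> and lowers
    \<open>n\<close>.\<close>
  have "[:0, 1:] * ([:[:0, 1:]:] ^ m * z - [:0, 1:] ^ n * y) =
      ([:[:0, 1:]:] ^ m * x - [:0, 1:] ^ Suc n * y) - [:[:0, 1:]:] ^ m * (x - [:0, 1:] * z)"
    unfolding power_Suc by (simp only: algebra_simps)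
  also have "\<dots> \<in> ideal2 f g" by (intro id Suc.prems z)
  finally have "[:[:0, 1:]:] ^ m * z - [:0, 1:] ^ n * y \<in> ideal2 f g"
    by (rule s_nonzerodivisor[rotated]) (erule syz1)
  then obtain h where h: "z - [:0, 1:] ^ n * h \<in> ideal2 f g" using Suc.IH by blast
  have "x - [:0, 1:] ^ Suc n * h = (x - [:0, 1:] * z) + [:0, 1:] * (z - [:0, 1:] ^ n * h)"
    unfolding power_Suc by (simp only: algebra_simps)
  also have "\<dots> \<in> ideal2 f g" by (intro id z h)
  finally show ?case by blast
qed

section \<open>Power and product identities, and polynomial functions of one variable\<close>

lemma power_add_combination:
  fixes p q :: "'a::comm_ring_1"
  shows "\<exists>u v. (p + q) ^ (m + n) = u * p ^ m + v * q ^ n"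
proof (induction "m + n" arbitrary: m n)
  case 0
  then show ?case by (auto intro: exI[of _ 0] exI[of _ 1])
next
  case (Suc k)
  consider "m = 0" | "n = 0" | m' n' where "m = Suc m'" "n = Suc n'" by (cases m; cases n) auto
  then show ?case
  proof cases
    case 1
    then have "(p + q) ^ (m + n) = (p + q) ^ n * p ^ m + 0 * q ^ n" by simp
    then show ?thesis by blast
  next
    case 2
    then have "(p + q) ^ (m + n) = 0 * p ^ m + (p + q) ^ m * q ^ n" by simp
    then show ?thesis by blast
  next
    case 3
    obtain u v where 1: "(p + q) ^ (m' + n) = u * p ^ m' + v * q ^ n"
      using Suc.hyps(1)[of m' n] Suc.hyps(2) 3 by auto
    obtain u' v' where 2: "(p + q) ^ (m + n') = u' * p ^ m + v' * q ^ n'"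
      using Suc.hyps(1)[of m n'] Suc.hyps(2) 3 by auto
    have "(p + q) ^ (m + n) = p * (p + q) ^ (m' + n) + q * (p + q) ^ (m + n')"
      using 3 by (simp add: algebra_simps)
    also have "\<dots> = (u + q * u') * p ^ m + (p * v + v') * q ^ n"
      unfolding 1 2 using 3 by (simp add: algebra_simps)
    finally show ?thesis by blast
  qed
qed

lemma diff_dvd_prod_diff:
  fixes x y :: "'a::comm_ring_1"
  shows "x - y dvd (\<Prod>i\<in>A. x - c i) - (\<Prod>i\<in>A. y - c i)"
proof (induction A rule: infinite_finite_induct)
  case (insert i A)
  have "(\<Prod>i\<in>insert i A. x - c i) - (\<Prod>i\<in>insert i A. y - c i) =
      (x - y) * (\<Prod>i\<in>A. x - c i) + (y - c i) * ((\<Prod>i\<in>A. x - c i) - (\<Prod>i\<in>A. y - c i))"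
    using insert by (simp add: algebra_simps)
  then show ?case using insert.IH by simp
qed auto

definition is_polyfun :: "('k::comm_ring_1 \<Rightarrow> 'k) \<Rightarrow> bool" where
  "is_polyfun F \<longleftrightarrow> (\<exists>r. \<forall>x. F x = poly r x)"

lemma is_polyfun_intros:
  "is_polyfun (\<lambda>x. c)" "is_polyfun (\<lambda>x. x)"
  "is_polyfun F \<Longrightarrow> is_polyfun G \<Longrightarrow> is_polyfun (\<lambda>x. F x + G x)"
  "is_polyfun F \<Longrightarrow> is_polyfun G \<Longrightarrow> is_polyfun (\<lambda>x. F x * G x)"
  "is_polyfun F \<Longrightarrow> is_polyfun (\<lambda>x. F x ^ n)"
  unfolding is_polyfun_def
  by (rule exI[of _ "[:c:]"], simp, rule exI[of _ "[:0, 1:]"], simp, metis poly_add, metis poly_mult, metis poly_power)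

lemma is_polyfun_hom_extend:
  assumes "\<And>x. is_ring_hom (\<phi> x)" "\<And>c. is_polyfun (\<lambda>x. \<phi> x c)" "is_polyfun y"
  shows "is_polyfun (\<lambda>x. hom_extend (\<phi> x) (y x) p)"
  by (induction p) (simp_all add: hom_extend_pCons assms is_polyfun_intros)

text \<open>Recovers a value at 0 from values where division by a power of the parameter is
  possible.\<close>

lemma is_polyfun_const_nonzero:
  fixes F :: "'k::alg_closed_field \<Rightarrow> 'k"
  assumes "is_polyfun F" "\<And>x. x \<noteq> 0 \<Longrightarrow> F x = c"
  shows "F x = c"
proof -
  obtain r where r: "\<And>x. F x = poly r x" using assms(1) by (auto simp: is_polyfun_def)
  have "r - [:c:] = 0"
  proof (rule ccontr)
    assume "r - [:c:] \<noteq> 0"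
    then have "finite {x. poly (r - [:c:]) x = 0}" by (rule poly_roots_finite)
    moreover have "UNIV - {0} \<subseteq> {x. poly (r - [:c:]) x = 0}" using assms(2) r by auto
    ultimately have "finite (UNIV - {0} :: 'k set)" using finite_subset by blast
    then show False using infinite_UNIV_alg_closed by auto
  qed
  then show ?thesis using r by simp
qed

section \<open>Unions of surfaces in affine 4-space\<close>

text \<open>The nesting order matters: \<open>s\<close> is outermost and \<open>t\<close> next, so
  setting them to 0 in this order is \<open>coeff _ 0\<close> once and twice, and leaves polynomials
  in \<open>y, z, t\<close> and in \<open>y, z\<close>.\<close>

type_synonym 'k poly4 = "'k poly poly poly poly"

abbreviation (input) "y_var \<equiv> [:[:[:[:0, 1:]:]:]:]"
abbreviation (input) "z_var \<equiv> [:[:[:0, 1:]:]:]"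
abbreviation (input) "t_var \<equiv> [:[:0, 1:]:]"
abbreviation (input) "s_var \<equiv> [:0, 1:]"
abbreviation (input) "const4 c \<equiv> [:[:[:[:c:]:]:]:]"

definition eval4 :: "'k::comm_ring_1 \<Rightarrow> 'k \<Rightarrow> 'k \<Rightarrow> 'k \<Rightarrow> 'k poly4 \<Rightarrow> 'k" where
  "eval4 y z t s = hom_extend (hom_extend (hom_extend (hom_extend (\<lambda>x. x) y) z) t) s"

lemma is_ring_hom_id: "is_ring_hom (\<lambda>x. x)"
  by (simp add: is_ring_hom_def)

lemma is_ring_hom_eval4: "is_ring_hom (eval4 y z t s)"
  unfolding eval4_def by (intro is_ring_hom_extend is_ring_hom_id)

lemma eval4_simps [simp]:
  "eval4 y z t s (p + q) = eval4 y z t s p + eval4 y z t s q"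
  "eval4 y z t s (p - q) = eval4 y z t s p - eval4 y z t s q"
  "eval4 y z t s (p * q) = eval4 y z t s p * eval4 y z t s q"
  "eval4 y z t s (p ^ n) = eval4 y z t s p ^ n"
  "eval4 y z t s (- p) = - eval4 y z t s p"
  "eval4 y z t s 0 = 0" "eval4 y z t s 1 = 1"
  "eval4 y z t s (\<Prod>i\<in>A. f i) = (\<Prod>i\<in>A. eval4 y z t s (f i))"
  by (simp_all add: is_ring_homD[OF is_ring_hom_eval4] is_ring_hom_prod[OF is_ring_hom_eval4])

lemma eval4_vars [simp]:
  "eval4 y z t s y_var = y" "eval4 y z t s z_var = z" "eval4 y z t s t_var = t"
  "eval4 y z t s s_var = s" "eval4 y z t s (const4 c) = c"
  by (simp_all add: eval4_def hom_extend_pCons is_ring_hom_extend is_ring_hom_id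
      is_ring_homD[OF is_ring_hom_extend, OF is_ring_hom_id]
      is_ring_homD[OF is_ring_hom_extend, OF is_ring_hom_extend, OF is_ring_hom_id]
      is_ring_homD[OF is_ring_hom_extend, OF is_ring_hom_extend, OF is_ring_hom_extend, OF is_ring_hom_id])

lemma eval4_smult [simp]: "eval4 y z t s (smult [:[:[:c:]:]:] p) = c * eval4 y z t s p"
  using eval4_simps(3)[of y z t s "const4 c" p] by simp

lemma is_polyfun_eval4:
  assumes "is_polyfun y" "is_polyfun z" "is_polyfun t" "is_polyfun s"
  shows "is_polyfun (\<lambda>x. eval4 (y x) (z x) (t x) (s x) p)"
  unfolding eval4_def
  by (intro is_polyfun_hom_extend is_ring_hom_extend is_ring_hom_id assms is_polyfun_intros(1))

text \<open>If no power of \<open>h\<close> lay in \<open>(f, g)\<close>, a prime over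
  \<open>(f, g)\<close> would avoid \<open>h\<close>; the Nullstellensatz property, lifted four
  times from the field, then gives a common zero of \<open>f, g\<close> with \<open>h\<close>
  nonzero.\<close>

lemma nullstellensatz_poly4:
  fixes f g h :: "'k::alg_closed_field poly4"
  assumes "\<And>y z t s. eval4 y z t s f = 0 \<Longrightarrow> eval4 y z t s g = 0 \<Longrightarrow> eval4 y z t s h = 0"
  obtains n where "h ^ n \<in> ideal2 f g"
proof (rule ccontr)
  assume "\<not> thesis"
  then have "h ^ n \<notin> ideal2 f g" for n using that by blast
  then obtain P where P: "is_prime_ideal P" "ideal2 f g \<subseteq> P" "h \<notin> P"
    using exists_prime_ideal_avoiding_powers[OF is_ideal_ideal2, of h f g] by blast
  let ?\<Phi> = "{hom_extend \<phi> x |\<phi> x. \<phi> \<in> {hom_extend \<phi> x |\<phi> x. \<phi> \<in> {hom_extend \<phi> x |\<phi> x.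
      \<phi> \<in> {hom_extend \<phi> (x :: 'k) |\<phi> x. \<phi> \<in> {\<lambda>x. x}}}}}"
  have NS: "nullstellensatz_property ?\<Phi>"
    by (intro nullstellensatz_property_poly nullstellensatz_property_field)
  have "\<exists>\<phi>\<in>?\<Phi>. (\<forall>p\<in>P. \<phi> p = 0) \<and> \<phi> h \<noteq> 0"
    by (rule nullstellensatz_propertyD[OF NS P(1,3)])
  then obtain \<phi> where \<phi>: "\<phi> \<in> ?\<Phi>" "\<And>p. p \<in> P \<Longrightarrow> \<phi> p = 0" "\<phi> h \<noteq> 0"
    by (elim bexE conjE) (rule that, assumption+, erule bspec, assumption)
  from \<phi>(1) obtain y z t s where "\<phi> = eval4 y z t s" unfolding eval4_def by auto
  moreover have "\<phi> f = 0" "\<phi> g = 0" using \<phi>(2) P(2) ideal2_gens by blast+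
  ultimately show False using assms[of y z t s] \<phi>(3) by simp
qed

text \<open>Supplies the regularity premise of \<open>koszul_syzygy\<close> for a power of
  \<open>y\<close> and a power of an element prime to \<open>y\<close>.\<close>

lemma prime_power_nonzerodivisor:
  fixes p :: "'a::idom"
  assumes p: "prime_elem p" and "\<not> p dvd q" "p ^ n dvd c * q ^ m"
  shows "p ^ n dvd c"
proof -
  have ndvd: "\<not> p dvd q ^ m" using assms prime_elem_dvd_power by blast
  show ?thesis
    using assms(3)
  proof (induction n arbitrary: c)
    case (Suc n)
    have "p dvd c * q ^ m" using Suc.prems by (metis dvd_mult_left power_Suc)
    then have "p dvd c" using p ndvd by (meson prime_elem_dvd_multD)
    then obtain c' where c: "c = p * c'" by blast
    have "p * p ^ n dvd p * (c' * q ^ m)" using Suc.prems by (simp add: c mult.assoc)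
    then have "p ^ n dvd c' * q ^ m" using p by (simp add: prime_elem_def)
    then have "p ^ n dvd c'" by (rule Suc.IH)
    then show ?case by (simp add: c mult_dvd_mono)
  qed auto
qed

lemma is_ring_hom_const4: "is_ring_hom (\<lambda>c. const4 c)"
  by (simp add: is_ring_hom_def flip: one_pCons)

text \<open>Modulo \<open>X - S\<close> each factor becomes \<open>(1 - c i) * S\<close>, with a
  nonzero constant. So away from \<open>S = 0\<close> the two sets of factors have no common
  zero.\<close>

lemma bezout_scaled_factors:
  fixes \<kappa> :: "'k::idom \<Rightarrow> 'r::comm_ring_1"
  assumes \<kappa>: "is_ring_hom \<kappa>" and fin: "finite A" and ne1: "\<And>i. i \<in> A \<Longrightarrow> c i \<noteq> 1"
  shows "\<exists>w e. e \<noteq> 0 \<and> \<kappa> e * S ^ card A = (\<Prod>i\<in>A. X - \<kappa> (c i) * S) + (X - S) * w"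
proof -
  obtain w where w: "(\<Prod>i\<in>A. X - \<kappa> (c i) * S) - (\<Prod>i\<in>A. S - \<kappa> (c i) * S) = (X - S) * w"
    using diff_dvd_prod_diff[of X S "\<lambda>i. \<kappa> (c i) * S" A] unfolding dvd_def by blast
  have "(\<Prod>i\<in>A. S - \<kappa> (c i) * S) = (\<Prod>i\<in>A. \<kappa> (1 - c i) * S)"
    by (simp add: is_ring_homD[OF \<kappa>] algebra_simps)
  also have "\<dots> = \<kappa> (\<Prod>i\<in>A. 1 - c i) * S ^ card A"
    by (simp add: prod.distrib is_ring_hom_prod[OF \<kappa>])
  finally have "\<kappa> (\<Prod>i\<in>A. 1 - c i) * S ^ card A = (\<Prod>i\<in>A. X - \<kappa> (c i) * S) + (X - S) * (- w)"
    using w by (simp add: algebra_simps)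
  moreover have "(\<Prod>i\<in>A. 1 - c i) \<noteq> 0" using ne1 fin by (auto simp: prod_zero_iff)
  ultimately show ?thesis by blast
qed

text \<open>Hartshorne's connectedness argument: the surface of \<open>(1, 1)\<close> meets each of the others only
  at the origin. The function that is \<open>0\<close> on it and \<open>1\<close> on the others would extend to a
  polynomial, because \<open>s, t\<close> form a regular sequence modulo \<open>f, g\<close>.\<close>

lemma union_of_surfaces_not_two_equations:
  fixes f g :: "'k::alg_closed_field poly4" and \<Gamma> :: "('k \<times> 'k) set"
  assumes fin: "finite \<Gamma>" and one: "(1, 1) \<in> \<Gamma>" and other: "\<gamma>0 \<in> \<Gamma>" "\<gamma>0 \<noteq> (1, 1)"
    and sep: "\<And>\<omega> \<theta>. (\<omega>, \<theta>) \<in> \<Gamma> \<Longrightarrow> \<omega> = 1 \<longleftrightarrow> \<theta> = 1"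
    and pos: "\<alpha> > 0" "\<beta> > 0"
    and locus: "\<And>y z t s. eval4 y z t s f = 0 \<and> eval4 y z t s g = 0 \<longleftrightarrow>
      (\<exists>(\<omega>, \<theta>)\<in>\<Gamma>. y = \<omega> * s ^ \<alpha> \<and> z = \<theta> * t ^ \<beta>)"
  shows False
proof -
  define \<Gamma>' where "\<Gamma>' = \<Gamma> - {(1, 1)}"
  have fin': "finite \<Gamma>'" using fin by (simp add: \<Gamma>'_def)
  have ne1: "fst \<gamma> \<noteq> 1" "snd \<gamma> \<noteq> 1" if "\<gamma> \<in> \<Gamma>'" for \<gamma>
    using that sep[of "fst \<gamma>" "snd \<gamma>"] by (auto simp: \<Gamma>'_def prod_eq_iff)
  \<comment> \<open>\<open>P1, P2\<close> vanish on the surface of \<open>(1, 1)\<close> and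
    \<open>Q1, Q2\<close> on all others, so each of the four products vanishes on the union.\<close>
  define P1 :: "'k poly4" where "P1 = y_var - s_var ^ \<alpha>"
  define Q1 :: "'k poly4" where "Q1 = (\<Prod>\<gamma>\<in>\<Gamma>'. y_var - const4 (fst \<gamma>) * s_var ^ \<alpha>)"
  define P2 :: "'k poly4" where "P2 = z_var - t_var ^ \<beta>"
  define Q2 :: "'k poly4" where "Q2 = (\<Prod>\<gamma>\<in>\<Gamma>'. z_var - const4 (snd \<gamma>) * t_var ^ \<beta>)"
  note id = is_idealD[OF is_ideal_ideal2[of f g]]
  have vanish: "eval4 y z t s h = 0" if "h \<in> ideal2 f g" "(\<omega>, \<theta>) \<in> \<Gamma>" "y = \<omega> * s ^ \<alpha>" "z = \<theta> * t ^ \<beta>"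
    for h y z t s \<omega> \<theta>
  proof -
    have "eval4 y z t s f = 0 \<and> eval4 y z t s g = 0" using locus that by blast
    then show ?thesis using that(1) by (auto simp: ideal2_iff)
  qed
  have membership: "\<exists>n. (P * Q) ^ n \<in> ideal2 f g" if "P \<in> {P1, P2}" "Q \<in> {Q1, Q2}" for P Q
  proof -
    have "eval4 y z t s (P * Q) = 0" if zero: "eval4 y z t s f = 0" "eval4 y z t s g = 0" for y z t s
    proof -
      obtain \<gamma> where \<gamma>: "\<gamma> \<in> \<Gamma>" "y = fst \<gamma> * s ^ \<alpha>" "z = snd \<gamma> * t ^ \<beta>" using locus zero by fastforce
      show ?thesis
      proof (cases "\<gamma> = (1, 1)")
        case True
        then have "eval4 y z t s P = 0" using \<gamma> \<open>P \<in> {P1, P2}\<close> by (auto simp: P1_def P2_def)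
        then show ?thesis by simp
      next
        case False
        then have "\<gamma> \<in> \<Gamma>'" using \<gamma> by (simp add: \<Gamma>'_def)
        then have "eval4 y z t s Q = 0" using \<gamma> \<open>Q \<in> {Q1, Q2}\<close> fin' by (auto simp: Q1_def Q2_def)
        then show ?thesis by simp
      qed
    qed
    then show ?thesis using nullstellensatz_poly4 by metis
  qed
  \<comment> \<open>One exponent for all four products; it is positive so that \<open>M\<close>-th
    powers of zero vanish when values are computed at the end.\<close>
  obtain M where M: "M > 0" "\<And>P Q. P \<in> {P1, P2} \<Longrightarrow> Q \<in> {Q1, Q2} \<Longrightarrow> (P * Q) ^ M \<in> ideal2 f g"
  proof -
    obtain n where n: "\<And>P Q. P \<in> {P1, P2} \<Longrightarrow> Q \<in> {Q1, Q2} \<Longrightarrow> (P * Q) ^ n P Q \<in> ideal2 f g"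
      using membership by metis
    define M where "M = Suc (n P1 Q1 + n P1 Q2 + n P2 Q1 + n P2 Q2)"
    have "(P * Q) ^ M \<in> ideal2 f g" if "P \<in> {P1, P2}" "Q \<in> {Q1, Q2}" for P Q
    proof -
      have "n P Q \<le> M" using that by (auto simp: M_def)
      then have "(P * Q) ^ M = (P * Q) ^ (M - n P Q) * (P * Q) ^ n P Q"
        by (simp add: power_add[symmetric])
      then show ?thesis using id(3)[OF n[OF that]] by metis
    qed
    then show ?thesis using that[of M] by (simp add: M_def)
  qed

  \<comment> \<open>Here \<open>sep\<close> enters: both entries of every other pair differ from 1,
    so powers of \<open>s\<close> and of \<open>t\<close> arise.\<close>
  have dvd1: "\<exists>w c n. c \<noteq> 0 \<and> const4 c * s_var ^ n = Q1 + P1 * w"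
    using bezout_scaled_factors[where c = fst and S = "s_var ^ \<alpha>" and X = y_var,
        OF is_ring_hom_const4 fin' ne1(1)]
    unfolding P1_def Q1_def power_mult[symmetric] by blast
  have dvd2: "\<exists>w c n. c \<noteq> 0 \<and> const4 c * t_var ^ n = Q2 + P2 * w"
    using bezout_scaled_factors[where c = snd and S = "t_var ^ \<beta>" and X = z_var,
        OF is_ring_hom_const4 fin' ne1(2)]
    unfolding P2_def Q2_def power_mult[symmetric] by blast
  have const4_power: "const4 c ^ n = const4 (c ^ n)" for c :: 'k and n
    by (simp add: is_ring_homD(7)[OF is_ring_hom_const4])
  obtain c1 N1 w1 where 1: "c1 \<noteq> 0" "const4 c1 * s_var ^ N1 = Q1 + P1 * w1" using dvd1 by blast
  obtain c2 N2 w2 where 2: "c2 \<noteq> 0" "const4 c2 * t_var ^ N2 = Q2 + P2 * w2" using dvd2 by blast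
  obtain u1 v1 where uv1: "(Q1 + P1 * w1) ^ (M + M) = v1 * Q1 ^ M + u1 * (P1 * w1) ^ M"
    using power_add_combination by blast
  obtain u2 v2 where uv2: "(Q2 + P2 * w2) ^ (M + M) = v2 * Q2 ^ M + u2 * (P2 * w2) ^ M"
    using power_add_combination by blast
  \<comment> \<open>\<open>h1\<close> is divisible by \<open>P1 ^ M\<close>, and
    \<open>e1 * s^n1 - h1\<close> by \<open>Q1 ^ M\<close>. So where \<open>s \<noteq> 0\<close>,
    \<open>h1 / (e1 * s^n1)\<close> is 0 on the surface of \<open>(1, 1)\<close> and 1 on the
    others; \<open>h2\<close> does the same with \<open>t\<close>.\<close>
  define h1 where "h1 = u1 * (P1 * w1) ^ M"
  define h2 where "h2 = u2 * (P2 * w2) ^ M"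
  define e1 where "e1 = c1 ^ (M + M)"
  define e2 where "e2 = c2 ^ (M + M)"
  define n1 where "n1 = N1 * (M + M)"
  define n2 where "n2 = N2 * (M + M)"
  have e: "e1 \<noteq> 0" "e2 \<noteq> 0" using 1 2 by (auto simp: e1_def e2_def)
  have eq1: "const4 e1 * s_var ^ n1 = v1 * Q1 ^ M + h1"
    using uv1 unfolding 1(2)[symmetric] power_mult_distrib const4_power e1_def n1_def h1_def power_mult .
  have eq2: "const4 e2 * t_var ^ n2 = v2 * Q2 ^ M + h2"
    using uv2 unfolding 2(2)[symmetric] power_mult_distrib const4_power e2_def n2_def h2_def power_mult .

  \<comment> \<open>Cross-multiplying the two fractions cancels \<open>h1 * h2\<close>; each
    remaining term contains \<open>(P1 * Q2) ^ M\<close> or \<open>(P2 * Q1) ^ M\<close>.\<close>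
  have "t_var ^ n2 * (const4 e2 * h1) - s_var ^ n1 * (const4 e1 * h2) =
      (const4 e2 * t_var ^ n2) * h1 - (const4 e1 * s_var ^ n1) * h2" by (simp only: mult_ac)
  also have "\<dots> = v2 * Q2 ^ M * h1 - v1 * Q1 ^ M * h2"
    unfolding eq1 eq2 by (simp only: algebra_simps)
  also have "\<dots> = (v2 * u1 * w1 ^ M) * (P1 * Q2) ^ M - (v1 * u2 * w2 ^ M) * (P2 * Q1) ^ M"
    unfolding h1_def h2_def power_mult_distrib by (simp only: mult_ac)
  also have "\<dots> \<in> ideal2 f g" by (intro id(3,5) M(2)) simp_all
  finally have glue: "t_var ^ n2 * (const4 e2 * h1) - s_var ^ n1 * (const4 e1 * h2) \<in> ideal2 f g" .

  have prime_y: "prime_elem [:[:0, 1 :: 'k:]:]" "prime_elem [:[:[:0, 1 :: 'k:]:]:]"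
    by (intro lift_prime_elem_poly prime_elem_linear_field_poly; simp)+
  have y_ndvd_z: "\<not> [:[:0, 1 :: 'k:]:] dvd [:0, 1:]"
  proof
    assume "[:[:0, 1 :: 'k:]:] dvd [:0, 1:]"
    then have "[:0, 1 :: 'k:] dvd coeff [:0, 1:] 1" unfolding const_poly_dvd_iff by blast
    then have "[:0, 1 :: 'k:] dvd 1" by simp
    then obtain r where "1 = [:0, 1 :: 'k:] * r" by blast
    then have "coeff 1 0 = coeff ([:0, 1 :: 'k:] * r) 0" by (rule arg_cong)
    then show False by simp
  qed
  have coeff_power: "coeff (p ^ n) 0 = coeff p 0 ^ n" for p :: "'b::comm_ring_1 poly" and n
    by (simp add: is_ring_homD(7)[OF is_ring_hom_coeff_0])
  have coeff_prod: "coeff (\<Prod>i\<in>A. F i) 0 = (\<Prod>i\<in>A. coeff (F i) 0)"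
    for F :: "'k \<times> 'k \<Rightarrow> 'b::comm_ring_1 poly" and A
    by (simp add: is_ring_hom_prod[OF is_ring_hom_coeff_0])
  \<comment> \<open>At \<open>s = 0\<close>, \<open>(P1 * Q1) ^ M\<close> becomes
    \<open>y ^ K\<close> and \<open>(P2 * Q2) ^ M\<close> becomes \<open>q ^ M\<close>. At
    \<open>t = 0\<close>, \<open>q\<close> is a power of \<open>z\<close>, so \<open>y\<close> does
    not divide \<open>q\<close> before or after setting \<open>t = 0\<close>.\<close>
  define K where "K = Suc (card \<Gamma>') * M"
  have "coeff (P1 * Q1) 0 = [:[:[:0, 1:]:]:] ^ Suc (card \<Gamma>')"
    using pos by (simp add: coeff_power coeff_0_mult P1_def Q1_def coeff_prod zero_power)
  then have red1: "coeff ((P1 * Q1) ^ M) 0 = [:[:[:0, 1:]:]:] ^ K"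
    unfolding coeff_power K_def power_mult by (rule arg_cong)
  define q where "q = coeff (P2 * Q2) 0"
  have q: "q = ([:[:0, 1:]:] - [:0, 1:] ^ \<beta>) * (\<Prod>\<gamma>\<in>\<Gamma>'. [:[:0, 1:]:] - [:[:[:snd \<gamma>:]:]:] * [:0, 1:] ^ \<beta>)"
    using pos by (simp add: q_def coeff_power coeff_0_mult P2_def Q2_def coeff_prod)
  have q0: "coeff q 0 = [:0, 1:] ^ Suc (card \<Gamma>')"
    using pos by (simp add: q coeff_power coeff_0_mult coeff_prod zero_power)
  have y_ndvd_q0: "\<not> [:[:0, 1:]:] dvd coeff q 0"
    unfolding q0 using prime_elem_dvd_power[OF prime_y(1)] y_ndvd_z by blast
  have y_ndvd_q: "\<not> [:[:[:0, 1:]:]:] dvd q"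
    using y_ndvd_q0 by (auto simp: const_poly_dvd_iff)
  have syz1: "\<exists>e. a = coeff g 0 * e \<and> b = - (coeff f 0 * e)" if "a * coeff f 0 + b * coeff g 0 = 0" for a b
  proof (rule koszul_syzygy[OF that])
    show "[:[:[:0, 1:]:]:] ^ K \<in> ideal2 (coeff f 0) (coeff g 0)"
      unfolding red1[symmetric] by (rule hom_ideal2[OF is_ring_hom_coeff_0 M(2)]) simp_all
    show "q ^ M \<in> ideal2 (coeff f 0) (coeff g 0)"
      unfolding q_def coeff_power[symmetric] by (rule hom_ideal2[OF is_ring_hom_coeff_0 M(2)]) simp_all
    show "[:[:[:0, 1:]:]:] ^ K dvd c" if "[:[:[:0, 1:]:]:] ^ K dvd c * q ^ M" for c
      by (rule prime_power_nonzerodivisor[OF prime_y(2) y_ndvd_q that])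
  qed auto
  have syz2: "\<exists>e. a = coeff (coeff g 0) 0 * e \<and> b = - (coeff (coeff f 0) 0 * e)"
    if "a * coeff (coeff f 0) 0 + b * coeff (coeff g 0) 0 = 0" for a b
  proof (rule koszul_syzygy[OF that])
    have "coeff (coeff ((P1 * Q1) ^ M) 0) 0 \<in> ideal2 (coeff (coeff f 0) 0) (coeff (coeff g 0) 0)"
      by (rule hom_ideal2[OF is_ring_hom_coeff_0_0 M(2)]) simp_all
    then show "[:[:0, 1:]:] ^ K \<in> ideal2 (coeff (coeff f 0) 0) (coeff (coeff g 0) 0)"
      unfolding red1 by (simp add: coeff_power)
    have "coeff (coeff ((P2 * Q2) ^ M) 0) 0 \<in> ideal2 (coeff (coeff f 0) 0) (coeff (coeff g 0) 0)"
      by (rule hom_ideal2[OF is_ring_hom_coeff_0_0 M(2)]) simp_all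
    then show "(coeff q 0) ^ M \<in> ideal2 (coeff (coeff f 0) 0) (coeff (coeff g 0) 0)"
      unfolding q_def coeff_power .
    show "[:[:0, 1:]:] ^ K dvd c" if "[:[:0, 1:]:] ^ K dvd c * (coeff q 0) ^ M" for c
      by (rule prime_power_nonzerodivisor[OF prime_y(1) y_ndvd_q0 that])
  qed auto
  obtain h where h: "const4 e2 * h1 - s_var ^ n1 * h \<in> ideal2 f g"
    using divide_power_mod_ideal2[OF _ _ glue] syz1 syz2 by blast

  \<comment> \<open>The curve \<open>(\<omega> * s^\<alpha>, 0, 0, s)\<close> lies on the surface of
    \<open>(\<omega>, \<theta>)\<close> because \<open>\<beta> > 0\<close>. On it \<open>h\<close>
    is forced for \<open>s \<noteq> 0\<close>: 0 for the pair \<open>(1, 1)\<close>, and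
    \<open>e2 * e1\<close> for \<open>\<gamma>0\<close>. Both curves reach the origin at
    \<open>s = 0\<close>.\<close>
  have on_line: "e2 * eval4 (\<omega> * s ^ \<alpha>) 0 0 s h1 = s ^ n1 * eval4 (\<omega> * s ^ \<alpha>) 0 0 s h"
    if "(\<omega>, \<theta>) \<in> \<Gamma>" for \<omega> \<theta> s
    using vanish[OF h that refl, of 0 0] pos by simp
  have polyfun: "is_polyfun (\<lambda>s. eval4 (\<omega> * s ^ \<alpha>) 0 0 s h)" for \<omega>
    by (intro is_polyfun_eval4 is_polyfun_intros)
  have "eval4 (1 * 0 ^ \<alpha>) 0 0 0 h = 0"
  proof (rule is_polyfun_const_nonzero[OF polyfun])
    fix s :: 'k assume "s \<noteq> 0"
    have "eval4 (1 * s ^ \<alpha>) 0 0 s h1 = 0" using M(1) by (simp add: h1_def P1_def)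
    then show "eval4 (1 * s ^ \<alpha>) 0 0 s h = 0" using on_line[OF one, of s] \<open>s \<noteq> 0\<close> by simp
  qed
  moreover have "eval4 (fst \<gamma>0 * 0 ^ \<alpha>) 0 0 0 h = e2 * e1"
  proof (rule is_polyfun_const_nonzero[OF polyfun])
    fix s :: 'k assume "s \<noteq> 0"
    have "eval4 (fst \<gamma>0 * s ^ \<alpha>) 0 0 s Q1 = 0"
      using other fin' by (auto simp: Q1_def \<Gamma>'_def)
    then have "eval4 (fst \<gamma>0 * s ^ \<alpha>) 0 0 s h1 = e1 * s ^ n1"
      using arg_cong[OF eq1, of "eval4 (fst \<gamma>0 * s ^ \<alpha>) 0 0 s"] M(1) by simp
    then show "eval4 (fst \<gamma>0 * s ^ \<alpha>) 0 0 s h = e2 * e1"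
      using on_line[of "fst \<gamma>0" "snd \<gamma>0" s] other \<open>s \<noteq> 0\<close> by simp
  qed
  ultimately show False using e pos by (simp add: zero_power)
qed

section \<open>Toric varieties\<close>

lemma mpoly_eval_superset:
  assumes "finite A" "Poly_Mapping.keys p \<subseteq> A"
  shows "mpoly_eval p z = (\<Sum>m\<in>A. Poly_Mapping.lookup p m * (\<Prod>v\<in>UNIV. (z $ v) ^ Poly_Mapping.lookup m v))"
  unfolding mpoly_eval_def using assms by (intro sum.mono_neutral_left) (auto simp: in_keys_iff)

lemma mpoly_eval_0 [simp]: "mpoly_eval 0 z = 0"
  by (simp add: mpoly_eval_def)

lemma mpoly_eval_diff: "mpoly_eval (p - q) z = mpoly_eval p z - mpoly_eval q z"
proof -
  let ?A = "Poly_Mapping.keys p \<union> Poly_Mapping.keys q"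
  have "Poly_Mapping.keys (p - q) \<subseteq> ?A"
    by (auto simp: in_keys_iff lookup_minus)
  then show ?thesis
    by (simp add: mpoly_eval_superset[of ?A] lookup_minus left_diff_distrib sum_subtractf)
qed

lemma mpoly_eval_single: "mpoly_eval (Poly_Mapping.single m c) z = c * (\<Prod>v\<in>UNIV. (z $ v) ^ Poly_Mapping.lookup m v)"
  by (subst mpoly_eval_superset[of "{m}"]) auto

definition mpoly_subst ::
    "('k::comm_ring_1 \<Rightarrow> 'r::comm_ring_1) \<Rightarrow> ('v::finite \<Rightarrow> 'r) \<Rightarrow> ('v, 'k) mpoly \<Rightarrow> 'r" where
  "mpoly_subst \<kappa> X p =
     (\<Sum>m\<in>Poly_Mapping.keys p. \<kappa> (Poly_Mapping.lookup p m) * (\<Prod>v\<in>UNIV. X v ^ Poly_Mapping.lookup m v))"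

lemma hom_mpoly_subst:
  assumes "is_ring_hom \<phi>" "\<And>c. \<phi> (\<kappa> c) = c"
  shows "\<phi> (mpoly_subst \<kappa> X p) = mpoly_eval p (\<chi> v. \<phi> (X v))"
  by (simp add: mpoly_subst_def mpoly_eval_def is_ring_hom_sum[OF assms(1)] is_ring_hom_prod[OF assms(1)]
      is_ring_homD[OF assms(1)] assms(2))

lemma is_polyfun_sum: "(\<And>i. i \<in> A \<Longrightarrow> is_polyfun (F i)) \<Longrightarrow> is_polyfun (\<lambda>x. \<Sum>i\<in>A. F i x)"
  by (induction A rule: infinite_finite_induct) (auto intro!: is_polyfun_intros)

lemma is_polyfun_prod: "(\<And>i. i \<in> A \<Longrightarrow> is_polyfun (F i)) \<Longrightarrow> is_polyfun (\<lambda>x. \<Prod>i\<in>A. F i x)"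
  by (induction A rule: infinite_finite_induct) (auto intro!: is_polyfun_intros)

lemma is_polyfun_mpoly_eval:
  fixes z :: "'k::comm_ring_1 \<Rightarrow> 'k ^ 'v::finite"
  assumes "\<And>v. is_polyfun (\<lambda>x. z x $ v)"
  shows "is_polyfun (\<lambda>x. mpoly_eval p (z x))"
  unfolding mpoly_eval_def by (intro is_polyfun_sum is_polyfun_prod is_polyfun_intros assms)

lemma zero_locus_le_two:
  fixes F :: "('v::finite, 'k::comm_ring_1) mpoly set"
  assumes "finite F" "card F \<le> 2"
  obtains f g where "zero_locus F = {z. mpoly_eval f z = 0 \<and> mpoly_eval g z = 0}"
proof -
  have "card F = 0 \<or> card F = 1 \<or> card F = 2" using assms(2) by linarith
  then consider "F = {}" | f where "F = {f}" | f g where "F = {f, g}"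
    using assms(1) by (auto simp: card_2_iff card_1_singleton_iff)
  then show ?thesis
  proof cases
    case 1
    then show ?thesis using that[of 0 0] by (simp add: zero_locus_def)
  next
    case (2 f)
    then show ?thesis using that[of f f] by (simp add: zero_locus_def)
  next
    case (3 f g)
    then show ?thesis using that[of f g] by (simp add: zero_locus_def)
  qed
qed

lemma toric_param_nth:
  "toric_param d a b u $ Inl i = (u $ i) ^ d"
  "toric_param d a b u $ Inr 1 = (\<Prod>i\<in>UNIV. (u $ i) ^ a i)"
  "toric_param d a b u $ Inr 2 = (\<Prod>i\<in>UNIV. (u $ i) ^ b i)"
  by (simp_all add: toric_param_def)

lemma vec_eq_iff_Plus_2:
  fixes z w :: "'a ^ ('n::finite + 2)"
  shows "z = w \<longleftrightarrow> (\<forall>i. z $ Inl i = w $ Inl i) \<and> z $ Inr 1 = w $ Inr 1 \<and> z $ Inr 2 = w $ Inr 2"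
  by (simp add: vec_eq_iff split_sum_all forall_2)

lemma prod_UNIV_Plus_2:
  fixes f :: "'n::finite + 2 \<Rightarrow> 'a::comm_monoid_mult"
  shows "(\<Prod>v\<in>UNIV. f v) = (\<Prod>i\<in>UNIV. f (Inl i)) * (f (Inr 1) * f (Inr 2))"
  unfolding UNIV_Plus_UNIV[symmetric] by (subst prod.Plus) (simp_all add: UNIV_2)

lemma in_toric_variety_iff:
  "z \<in> toric_variety d a b \<longleftrightarrow> (\<exists>u. (\<forall>i. z $ Inl i = u i ^ d) \<and>
     z $ Inr 1 = (\<Prod>i\<in>UNIV. u i ^ a i) \<and> z $ Inr 2 = (\<Prod>i\<in>UNIV. u i ^ b i))"
proof -
  have "z \<in> toric_variety d a b \<longleftrightarrow> (\<exists>u. z = toric_param d a b (vec_lambda u))"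
    unfolding toric_variety_def by (metis (mono_tags, lifting) image_iff rangeI UNIV_I vec_nth_inverse)
  then show ?thesis by (simp add: vec_eq_iff_Plus_2 toric_param_nth)
qed

section \<open>Roots of unity and proportional rows modulo \<open>d\<close>\<close>

lemma power_cong_mod:
  fixes x :: "'a::comm_monoid_mult"
  assumes "x ^ d = 1" "[m = n] (mod d)"
  shows "x ^ m = x ^ n"
proof -
  obtain k1 k2 where "n + k1 * d = m + k2 * d" using assms(2) unfolding cong_iff_lin_nat by blast
  then have "x ^ n * (x ^ d) ^ k1 = x ^ m * (x ^ d) ^ k2"
    by (metis power_add power_mult mult.commute)
  then show ?thesis using assms(1) by simp
qed

lemma root_of_unity_coprime_power:
  fixes x :: "'a::comm_monoid_mult"
  assumes "x ^ m = 1" "x ^ n = 1" "coprime m n" "m > 0"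
  shows "x = 1"
proof -
  obtain i j where "m * i = n * j + gcd m n" using bezout_nat[of m n] assms(4) by auto
  then have "(x ^ m) ^ i = (x ^ n) ^ j * x" using assms(3) by (simp add: power_mult[symmetric] power_add mult.commute[of x])
  then show ?thesis using assms(1,2) by simp
qed

text \<open>A root of \<open>1 + X + ... + X^(q-1)\<close> works, because the value of this
  polynomial at 1 is \<open>q\<close>, nonzero in the field.\<close>

lemma exists_nontrivial_root_of_unity:
  assumes "prime q" "of_nat q \<noteq> (0 :: 'k)"
  obtains \<zeta> :: "'k::alg_closed_field" where "\<zeta> ^ q = 1" "\<zeta> \<noteq> 1"
proof -
  define P :: "'k poly" where "P = (\<Sum>i<q. monom 1 i)"
  have q: "q \<ge> 2" using assms(1) by (rule prime_ge_2_nat)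
  have "coeff P (q - 1) = 1" using q by (simp add: P_def coeff_sum)
  then have "degree P > 0" using le_degree[of P "q - 1"] q by auto
  then obtain \<zeta> where "poly P \<zeta> = 0" using alg_closed_imp_poly_has_root by blast
  then have \<zeta>: "(\<Sum>i<q. \<zeta> ^ i) = 0" by (simp add: P_def poly_sum poly_monom)
  then have "\<zeta> \<noteq> 1" using assms(2) by auto
  moreover have "\<zeta> ^ q = 1" using power_diff_1_eq[of \<zeta> q] \<zeta> by simp
  ultimately show ?thesis using that by blast
qed

lemma nat_multiple_mod:
  fixes k :: int and d :: nat and a b :: "'n \<Rightarrow> nat"
  assumes "d > 0" "\<And>i. [int (b i) = k * int (a i)] (mod int d)"
  shows "\<exists>k::nat. \<forall>i. [b i = k * a i] (mod d)"
proof -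
  obtain k' where k': "k mod int d = int k'" using assms(1) by (metis nonneg_int_cases pos_mod_sign of_nat_0_less_iff)
  have "[b i = k' * a i] (mod d)" for i
  proof -
    have "[int (b i) = (k mod int d) * int (a i)] (mod int d)"
      using assms(2)[of i] by (simp add: cong_def mod_mult_left_eq)
    then show ?thesis unfolding k' of_nat_mult[symmetric] cong_int_iff .
  qed
  then show ?thesis by blast
qed

text \<open>The entry \<open>b l\<close> is a unit modulo \<open>d\<close> and congruent to
  \<open>k * a l\<close>, so \<open>k\<close> is a unit and proportionality can be reversed.\<close>

lemma invert_multiple_mod:
  fixes k d :: nat and a b :: "'n \<Rightarrow> nat"
  assumes k: "\<And>i. [b i = k * a i] (mod d)" and l: "coprime d (b l)"
  shows "\<exists>k::nat. \<forall>i. [a i = k * b i] (mod d)"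
proof -
  have "coprime d (k * a l)" using l k[of l] by (metis cong_imp_coprime coprime_commute)
  then have "coprime k d" by (simp add: coprime_commute)
  then obtain k' where k': "[k * k' = 1] (mod d)" using cong_solve_coprime_nat by auto
  have "[a i = k' * b i] (mod d)" for i
  proof -
    have "[k' * b i = k' * (k * a i)] (mod d)" using k[of i] by (rule cong_scalar_left)
    also have "k' * (k * a i) = k * k' * a i" by simp
    also have "[k * k' * a i = 1 * a i] (mod d)" using k' by (rule cong_scalar_right)
    finally show ?thesis by (simp add: cong_sym_eq)
  qed
  then show ?thesis by blast
qed

text \<open>The product of the given roots differs from \<open>y\<close> by some
  \<open>\<zeta>\<close> with \<open>\<zeta>^d = 1\<close>. With \<open>a l * m\<close> congruent to
  1, multiplying \<open>u l\<close> by \<open>\<zeta>^m\<close> keeps its \<open>d\<close>-th power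
  and changes the product by exactly \<open>\<zeta>\<close>.\<close>

lemma adjust_root:
  fixes x u :: "'n::finite \<Rightarrow> 'k::field"
  assumes d: "d > 0" and u: "\<And>i. u i ^ d = x i" and l: "coprime (a l) d" and y: "y \<noteq> 0" "y ^ d = (\<Prod>i\<in>UNIV. x i ^ a i)"
  shows "\<exists>u'. (\<forall>i. u' i ^ d = x i) \<and> (\<Prod>i\<in>UNIV. u' i ^ a i) = y"
proof -
  let ?p = "\<Prod>i\<in>UNIV. u i ^ a i"
  have pd: "?p ^ d = y ^ d" unfolding y(2) u[symmetric] prod_power_distrib
    by (simp add: power_mult[symmetric] mult.commute)
  have p0: "?p \<noteq> 0"
  proof
    assume "?p = 0"
    then have "y ^ d = 0" using pd d by (metis zero_power)
    then show False using y(1) by simp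
  qed
  define \<zeta> where "\<zeta> = y / ?p"
  have \<zeta>: "\<zeta> ^ d = 1" unfolding \<zeta>_def power_divide pd using y(1) by simp
  obtain m where m: "[a l * m = 1] (mod d)" using cong_solve_coprime_nat[OF l] by auto
  define u' where "u' = u(l := u l * \<zeta> ^ m)"
  have "u' i ^ d = x i" for i
    using u \<zeta> by (simp add: u'_def power_mult_distrib power_mult[symmetric] mult.commute[of m] power_mult)
  moreover have "(\<Prod>i\<in>UNIV. u' i ^ a i) = y"
  proof -
    have "(\<Prod>i\<in>UNIV. u' i ^ a i) = u' l ^ a l * (\<Prod>i\<in>UNIV - {l}. u' i ^ a i)"
      by (rule prod.remove) auto
    also have "(\<Prod>i\<in>UNIV - {l}. u' i ^ a i) = (\<Prod>i\<in>UNIV - {l}. u i ^ a i)"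
      by (rule prod.cong) (auto simp: u'_def)
    also have "u' l ^ a l = u l ^ a l * \<zeta> ^ (a l * m)"
      by (simp add: u'_def power_mult_distrib power_mult[symmetric] mult.commute[of m])
    also have "\<zeta> ^ (a l * m) = \<zeta>" using power_cong_mod[OF \<zeta> m] by simp
    also have "u l ^ a l * \<zeta> * (\<Prod>i\<in>UNIV - {l}. u i ^ a i) = \<zeta> * ?p"
      by (subst prod.remove[of UNIV l "\<lambda>i. u i ^ a i"]) (simp_all add: mult_ac)
    finally show ?thesis using p0 by (simp add: \<zeta>_def)
  qed
  ultimately show ?thesis by blast
qed

section \<open>The upper bound: three binomial equations\<close>

definition monomial :: "('n::finite \<Rightarrow> nat) \<Rightarrow> nat \<Rightarrow> nat \<Rightarrow> ('n + 2, 'k::comm_ring_1) mpoly" where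
  "monomial e p q =
     Poly_Mapping.single (Abs_poly_mapping (case_sum e (\<lambda>j. if j = 1 then p else q))) 1"

lemma mpoly_eval_monomial:
  "mpoly_eval (monomial e p q) z = (\<Prod>i\<in>UNIV. (z $ Inl i) ^ e i) * ((z $ Inr 1) ^ p * (z $ Inr 2) ^ q)"
  by (simp add: monomial_def mpoly_eval_single prod_UNIV_Plus_2 Abs_poly_mapping_inverse)

text \<open>Given a zero with \<open>y\<^sub>1 \<noteq> 0\<close>, the roots \<open>u\<close> can be
  adjusted to produce \<open>y\<^sub>1\<close>, and the mixed relation then forces
  \<open>y\<^sub>2\<close>. Coordinates equal to 0 are the delicate case and are treated
  separately.\<close>

lemma toric_variety_three_equations:
  fixes a b :: "'n::finite \<Rightarrow> nat"
  assumes d: "d > 0" and nz: "\<And>i. a i \<noteq> 0 \<or> b i \<noteq> 0"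
    and k: "\<And>i. [b i = k * a i] (mod d)" and l: "coprime (a l) d" "coprime (b l) d"
  obtains F where "finite F" "card F \<le> 3"
    "zero_locus F = (toric_variety d a b :: ('k::alg_closed_field ^ ('n + 2)) set)"
proof -
  \<comment> \<open>Both \<open>r\<close> and \<open>s\<close> occur in order to write the
    congruence with natural exponents: the mixed relation is
    \<open>x^r * y\<^sub>1^k = x^s * y\<^sub>2\<close>.\<close>
  have "\<forall>i. \<exists>r s. k * a i + r * d = b i + s * d"
    using k unfolding cong_iff_lin_nat by blast
  then obtain r s where rs: "\<And>i. k * a i + r i * d = b i + s i * d" by metis
  define F :: "('n + 2, 'k) mpoly set" where
    "F = {monomial a 0 0 - monomial (\<lambda>_. 0) d 0, monomial b 0 0 - monomial (\<lambda>_. 0) 0 d,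
          monomial r k 0 - monomial s 0 1}"
  have F: "z \<in> zero_locus F \<longleftrightarrow> (z $ Inr 1) ^ d = (\<Prod>i\<in>UNIV. (z $ Inl i) ^ a i) \<and>
      (z $ Inr 2) ^ d = (\<Prod>i\<in>UNIV. (z $ Inl i) ^ b i) \<and>
      (\<Prod>i\<in>UNIV. (z $ Inl i) ^ r i) * (z $ Inr 1) ^ k = (\<Prod>i\<in>UNIV. (z $ Inl i) ^ s i) * z $ Inr 2" for z
    by (auto simp: zero_locus_def F_def mpoly_eval_diff mpoly_eval_monomial)
  have third: "(\<Prod>i\<in>UNIV. (u i ^ d) ^ r i) * (\<Prod>i\<in>UNIV. u i ^ a i) ^ k =
      (\<Prod>i\<in>UNIV. (u i ^ d) ^ s i) * (\<Prod>i\<in>UNIV. u i ^ b i)" for u :: "'n \<Rightarrow> 'k"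
  proof -
    have "(u i ^ d) ^ r i * (u i ^ a i) ^ k = u i ^ (k * a i + r i * d)" for i
      by (simp add: power_mult[symmetric] power_add[symmetric] algebra_simps)
    moreover have "(u i ^ d) ^ s i * u i ^ b i = u i ^ (b i + s i * d)" for i
      by (simp add: power_mult[symmetric] power_add[symmetric] algebra_simps)
    ultimately show ?thesis by (simp add: prod_power_distrib prod.distrib[symmetric] rs)
  qed
  have powd: "(\<Prod>i\<in>UNIV. u i ^ c i) ^ d = (\<Prod>i\<in>UNIV. (u i ^ d) ^ c i)" for u :: "'n \<Rightarrow> 'k" and c
    by (simp add: prod_power_distrib power_mult[symmetric] mult.commute)
  have "z \<in> zero_locus F \<longleftrightarrow> z \<in> toric_variety d a b" for z
  proof
    assume "z \<in> toric_variety d a b"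
    then obtain u where u: "\<And>i. z $ Inl i = u i ^ d" "z $ Inr 1 = (\<Prod>i\<in>UNIV. u i ^ a i)"
      "z $ Inr 2 = (\<Prod>i\<in>UNIV. u i ^ b i)" unfolding in_toric_variety_iff by blast
    show "z \<in> zero_locus F" unfolding F u using third powd by simp
  next
    assume "z \<in> zero_locus F"
    then have eq: "(z $ Inr 1) ^ d = (\<Prod>i\<in>UNIV. (z $ Inl i) ^ a i)"
        "(z $ Inr 2) ^ d = (\<Prod>i\<in>UNIV. (z $ Inl i) ^ b i)"
        "(\<Prod>i\<in>UNIV. (z $ Inl i) ^ r i) * (z $ Inr 1) ^ k = (\<Prod>i\<in>UNIV. (z $ Inl i) ^ s i) * z $ Inr 2"
      unfolding F by blast+
    have "\<forall>i. \<exists>w. w ^ d = z $ Inl i" using nth_root_exists[of d] d by blast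
    then obtain u0 where u0: "\<And>i. u0 i ^ d = z $ Inl i" by metis
    have zero: "(\<Prod>i\<in>UNIV. u i ^ c i) = 0"
      if "\<And>i. u i ^ d = z $ Inl i" "(\<Prod>i\<in>UNIV. (z $ Inl i) ^ c i) = 0" for u c
      using powd[of u c] that d by simp
    have pow0: "0 ^ d = (0 :: 'k)" using d by simp
    show "z \<in> toric_variety d a b"
    proof (cases "z $ Inr 1 = 0")
      \<comment> \<open>Any choice of roots gives \<open>y\<^sub>1 = 0\<close>, so the freedom can
        be spent on matching \<open>y\<^sub>2\<close>.\<close>
      case y1: True
      show ?thesis
      proof (cases "z $ Inr 2 = 0")
        case True
        then show ?thesis
          unfolding in_toric_variety_iff using y1 u0 zero[of u0] eq(1,2) pow0 by (intro exI[of _ u0]) simp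
      next
        case False
        from adjust_root[OF d u0 l(2) False eq(2)]
        obtain u where "\<And>i. u i ^ d = z $ Inl i" "(\<Prod>i\<in>UNIV. u i ^ b i) = z $ Inr 2" by blast
        then show ?thesis
          unfolding in_toric_variety_iff using y1 zero[of u a] eq(1) pow0 by (intro exI[of _ u]) simp
      qed
    next
      case y1: False
      from adjust_root[OF d u0 l(1) y1 eq(1)]
      obtain u where u: "\<And>i. u i ^ d = z $ Inl i" "(\<Prod>i\<in>UNIV. u i ^ a i) = z $ Inr 1" by blast
      have "(\<Prod>i\<in>UNIV. u i ^ b i) = z $ Inr 2"
      proof (cases "z $ Inr 2 = 0")
        case True
        then show ?thesis using zero[of u b] u eq(2) pow0 by simp
      next
        case False
        \<comment> \<open>Each \<open>x\<^sub>i\<close> occurs in one of the two nonzero products by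
          \<open>nz\<close>, so no \<open>x\<^sub>i\<close> is 0 and \<open>x^s\<close> can be
          cancelled.\<close>
        have "(\<Prod>i\<in>UNIV. (z $ Inl i) ^ a i) \<noteq> 0" "(\<Prod>i\<in>UNIV. (z $ Inl i) ^ b i) \<noteq> 0"
          using eq(1,2) y1 False by (metis power_not_zero)+
        then have "z $ Inl i \<noteq> 0" for i using nz[of i] by (auto simp: prod_zero_iff power_0_left)
        then have nz: "(\<Prod>i\<in>UNIV. (z $ Inl i) ^ s i) \<noteq> 0" by simp
        have "(\<Prod>i\<in>UNIV. (z $ Inl i) ^ s i) * (\<Prod>i\<in>UNIV. u i ^ b i) = (\<Prod>i\<in>UNIV. (z $ Inl i) ^ s i) * z $ Inr 2"
          by (rule trans[OF sym[OF third[of u, unfolded u]] eq(3)])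
        then show ?thesis using nz by (simp only: mult_left_cancel not_False_eq_True)
      qed
      then show ?thesis unfolding in_toric_variety_iff using u by (intro exI[of _ u]) simp
    qed
  qed
  then have "zero_locus F = toric_variety d a b" by blast
  moreover have "finite F" "card F \<le> 3" by (auto simp: F_def card_insert_if)
  ultimately show ?thesis using that by blast
qed

section \<open>Dimension: a chain of coordinate faces\<close>

definition coordinate_subspace :: "'n set \<Rightarrow> ('k::zero ^ 'n::finite) set" where
  "coordinate_subspace S = {u. \<forall>i. i \<notin> S \<longrightarrow> u $ i = 0}"

text \<open>Closed because \<open>u\<^sub>i^d = 0\<close> only for \<open>u\<^sub>i = 0\<close>, so
  the face is cut out of \<open>V\<close> by the equations \<open>x\<^sub>i = 0\<close> outside
  \<open>S\<close>. Irreducible because it is the image of a linear space.\<close>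

lemma irreducible_closed_toric_face:
  fixes a b :: "'n::finite \<Rightarrow> nat" and S :: "'n set"
  assumes closed: "zariski_closed (toric_variety d a b :: ('k::alg_closed_field ^ ('n + 2)) set)" and d: "d > 0"
  shows "irreducible_closed (toric_param d a b ` (coordinate_subspace S :: ('k ^ 'n) set))" (is "irreducible_closed ?Z")
  unfolding irreducible_closed_def
proof (intro conjI allI impI)
  obtain F where F: "(toric_variety d a b :: ('k ^ ('n + 2)) set) = zero_locus F"
    using closed by (auto simp: zariski_closed_def)
  define G :: "('n + 2, 'k) mpoly set" where "G = (\<lambda>i. monomial (\<lambda>j. if j = i then 1 else 0) 0 0) ` (- S)"
  have "x ^ (if c then 1 else 0) = (if c then x else 1)" for x :: 'k and c by simp
  then have "mpoly_eval (monomial (\<lambda>j. if j = i then 1 else 0) 0 0) z = z $ Inl i" for i and z :: "'k ^ ('n + 2)"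
    by (simp add: mpoly_eval_monomial)
  then have G: "z \<in> zero_locus G \<longleftrightarrow> (\<forall>i. i \<notin> S \<longrightarrow> z $ Inl i = 0)" for z
    by (auto simp: zero_locus_def G_def)
  have "?Z = zero_locus (F \<union> G)"
  proof -
    have "zero_locus (F \<union> G) = zero_locus F \<inter> zero_locus G" by (auto simp: zero_locus_def)
    also have "\<dots> = ?Z"
      using d unfolding F[symmetric] toric_variety_def by (auto simp: G toric_param_nth coordinate_subspace_def)
    finally show ?thesis by simp
  qed
  then show "zariski_closed ?Z" by (auto simp: zariski_closed_def)
  have "0 \<in> (coordinate_subspace S :: ('k ^ 'n) set)" by (simp add: coordinate_subspace_def)
  then show "?Z \<noteq> {}" by blast
next
  fix A B assume AB: "zariski_closed A \<and> zariski_closed B \<and> ?Z = A \<union> B"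
  show "?Z = A \<or> ?Z = B"
  proof (rule ccontr)
    assume neg: "\<not> ?thesis"
    obtain FA FB where FAB: "A = zero_locus FA" "B = zero_locus FB" using AB by (auto simp: zariski_closed_def)
    obtain u1 u2 :: "'k ^ 'n" where u: "u1 \<in> coordinate_subspace S" "toric_param d a b u1 \<notin> A"
        "u2 \<in> coordinate_subspace S" "toric_param d a b u2 \<notin> B"
      using neg AB by blast
    obtain p q where p: "p \<in> FA" "mpoly_eval p (toric_param d a b u1) \<noteq> 0"
      and q: "q \<in> FB" "mpoly_eval q (toric_param d a b u2) \<noteq> 0"
      using u FAB by (auto simp: zero_locus_def)
    \<comment> \<open>The line joining a parameter outside \<open>A\<close> to one outside
      \<open>B\<close>: along it the two witnessing equations are nonzero polynomials, so some point
      avoids the zeros of both.\<close>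
    define L where "L x = (\<chi> i. u1 $ i + x * (u2 $ i - u1 $ i))" for x
    have L01: "L 0 = u1" "L 1 = u2" by (simp_all add: L_def vec_eq_iff)
    have poly: "is_polyfun (\<lambda>x. mpoly_eval m (toric_param d a b (L x)))" for m
    proof (rule is_polyfun_mpoly_eval)
      fix v show "is_polyfun (\<lambda>x. toric_param d a b (L x) $ v)"
      proof (cases v)
        case (Inr j)
        then show ?thesis
          by (cases "j = 1") (auto simp: toric_param_def L_def intro!: is_polyfun_prod is_polyfun_intros)
      qed (auto simp: toric_param_def L_def intro!: is_polyfun_intros)
    qed
    obtain P Q where PQ: "\<And>x. mpoly_eval p (toric_param d a b (L x)) = poly P x"
        "\<And>x. mpoly_eval q (toric_param d a b (L x)) = poly Q x"
      using poly[of p] poly[of q] unfolding is_polyfun_def by auto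
    have "P \<noteq> 0" "Q \<noteq> 0" using PQ(1)[of 0] PQ(2)[of 1] p q L01 by auto
    then obtain x where x: "poly (P * Q) x \<noteq> 0" using poly_nonroot[of "P * Q"] by auto
    have "toric_param d a b (L x) \<in> ?Z" using u(1,3) by (intro imageI) (simp add: L_def coordinate_subspace_def)
    then have "mpoly_eval p (toric_param d a b (L x)) = 0 \<or> mpoly_eval q (toric_param d a b (L x)) = 0"
      using AB FAB p(1) q(1) by (auto simp: zero_locus_def)
    then show False using x PQ by simp
  qed
qed

text \<open>The coordinates are numbered by \<open>idx\<close>; the faces using the first
  \<open>r\<close> of them, for \<open>r\<close> from 0 to the number of parameters, increase
  strictly.\<close>

lemma krull_dim_toric_variety_ge:
  fixes a b :: "'n::finite \<Rightarrow> nat"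
  assumes closed: "zariski_closed (toric_variety d a b :: ('k::alg_closed_field ^ ('n + 2)) set)" and d: "d > 0"
  shows "enat CARD('n) \<le> krull_dim (toric_variety d a b :: ('k ^ ('n + 2)) set)"
proof -
  obtain idx :: "'n \<Rightarrow> nat" where idx: "bij_betw idx UNIV {0..<CARD('n)}"
    using ex_bij_betw_finite_nat[of "UNIV :: 'n set"] by auto
  define Z where "Z r = toric_param d a b ` (coordinate_subspace {i. idx i < r} :: ('k ^ 'n) set)" for r
  have "irreducible_closed (Z r)" for r
    unfolding Z_def by (rule irreducible_closed_toric_face[OF closed d])
  moreover have "Z r \<subseteq> toric_variety d a b" for r
    unfolding Z_def toric_variety_def by blast
  moreover have "Z r \<subset> Z (Suc r)" if "r < CARD('n)" for r
  proof -
    have "Z r \<subseteq> Z (Suc r)" unfolding Z_def by (intro image_mono) (auto simp: coordinate_subspace_def)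
    moreover obtain i where i: "idx i = r"
      using idx \<open>r < CARD('n)\<close> unfolding bij_betw_def by (metis (no_types) atLeastLessThan_iff imageE le0)
    let ?u = "(\<chi> j. if idx j < Suc r then 1 else 0) :: 'k ^ 'n"
    have "toric_param d a b ?u \<in> Z (Suc r)" unfolding Z_def by (intro imageI) (simp add: coordinate_subspace_def)
    moreover have "toric_param d a b ?u \<notin> Z r"
    proof
      assume "toric_param d a b ?u \<in> Z r"
      then obtain u :: "'k ^ 'n" where u: "toric_param d a b ?u = toric_param d a b u" "u $ i = 0"
        using i unfolding Z_def coordinate_subspace_def by auto
      have "toric_param d a b ?u $ Inl i = toric_param d a b u $ Inl i" using u(1) by simp
      then show False using i d u(2) by (simp add: toric_param_nth zero_power)
    qed
    ultimately show ?thesis by blast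
  qed
  ultimately show ?thesis unfolding krull_dim_def by (intro SUP_upper CollectI exI[of _ Z]) auto
qed

section \<open>The lower bound: two equations do not suffice\<close>

text \<open>Restricting two equations to the slice leaves two equations in four variables, for the
  surfaces indexed by \<open>\<Gamma>\<close>. Both \<open>k\<close> and \<open>k'\<close> are
  supplied because \<open>\<theta> = \<omega>^k\<close> and \<open>\<omega> = \<theta>^k'\<close>
  together give the separation of \<open>(1, 1)\<close> from the other pairs.\<close>

lemma toric_variety_not_two_equations:
  fixes d :: nat and a b :: "'n::finite \<Rightarrow> nat"
  assumes d: "d > 1"
    and A: "a i = 0" "b i \<noteq> 0" "a j \<noteq> 0" "b j = 0" and dvd: "d dvd b i" "d dvd a j"
    and k: "\<And>i. [b i = k * a i] (mod d)" and k': "\<And>i. [a i = k' * b i] (mod d)"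
    and l: "coprime (a l) d"
    and two_primes: "prime p" "prime q" "p \<noteq> q" "p dvd d" "q dvd d"
    and F: "finite F" "zero_locus F = (toric_variety d a b :: ('k::alg_closed_field ^ ('n + 2)) set)"
  shows "card F > 2"
proof (rule ccontr)
  assume "\<not> card F > 2"
  then have "card F \<le> 2" by simp
  obtain f g where fg: "zero_locus F = {z. mpoly_eval f z = 0 \<and> mpoly_eval g z = 0}"
    using zero_locus_le_two[OF F(1) \<open>card F \<le> 2\<close>] by blast
  obtain \<alpha> where \<alpha>: "a j = d * \<alpha>" using dvd(2) by blast
  obtain \<beta> where \<beta>: "b i = d * \<beta>" using dvd(1) by blast
  have pos: "\<alpha> > 0" "\<beta> > 0" using A \<alpha> \<beta> by auto
  have ij: "i \<noteq> j" using A by auto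
  \<comment> \<open>Since \<open>d > 1\<close> divides both \<open>a i = 0\<close> and
    \<open>a j\<close>, neither is prime to \<open>d\<close>. So \<open>l\<close> indexes a
    parameter that stays free on the slice.\<close>
  have lij: "l \<noteq> i" "l \<noteq> j" using A(1) l d dvd(2) by (auto simp: coprime_absorb_left coprime_absorb_right)
  \<comment> \<open>On the slice \<open>x\<^sub>m = 1\<close> for \<open>m \<in> R\<close>, so these
    parameters are \<open>d\<close>-th roots of unity; \<open>\<Gamma>\<close> collects what they
    contribute to \<open>y\<^sub>1\<close> and \<open>y\<^sub>2\<close>.\<close>
  define R where "R = - {i, j}"
  define \<Gamma> :: "('k \<times> 'k) set" where
    "\<Gamma> = {(\<Prod>m\<in>R. u m ^ a m, \<Prod>m\<in>R. u m ^ b m) |u. \<forall>m\<in>R. u m ^ d = 1}"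
  have split: "(\<Prod>m\<in>UNIV. h m) = h i * h j * (\<Prod>m\<in>R. h m)" for h :: "'n \<Rightarrow> 'k"
  proof -
    have "UNIV = insert i (insert j R)" by (auto simp: R_def)
    then have "(\<Prod>m\<in>UNIV. h m) = (\<Prod>m\<in>insert i (insert j R). h m)" by (rule arg_cong)
    then show ?thesis using ij by (simp add: R_def mult.assoc)
  qed
  have prod_unity: "(\<Prod>m\<in>R. u m ^ c m) ^ d = 1" if "\<forall>m\<in>R. u m ^ d = 1" for u :: "'n \<Rightarrow> 'k" and c
  proof -
    have "(\<Prod>m\<in>R. u m ^ c m) ^ d = (\<Prod>m\<in>R. (u m ^ d) ^ c m)"
      by (simp add: prod_power_distrib power_mult[symmetric] mult.commute)
    also have "\<dots> = 1" using that by simp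
    finally show ?thesis .
  qed
  have proportional: "(\<Prod>m\<in>R. u m ^ c' m) = (\<Prod>m\<in>R. u m ^ c m) ^ k"
    if "\<forall>m\<in>R. u m ^ d = 1" "\<And>m. [c' m = k * c m] (mod d)" for u :: "'n \<Rightarrow> 'k" and c c' k
  proof -
    have "u m ^ c' m = (u m ^ c m) ^ k" if "m \<in> R" for m
      using power_cong_mod[of "u m" d "c' m" "k * c m"] that \<open>\<forall>m\<in>R. u m ^ d = 1\<close> \<open>[c' m = k * c m] (mod d)\<close>
      by (simp add: power_mult[symmetric] mult.commute)
    then show ?thesis by (simp add: prod_power_distrib)
  qed
  have unity: "finite {x :: 'k. x ^ d = 1}"
  proof -
    have "coeff (monom 1 d - 1 :: 'k poly) d = 1" using d by simp
    then have "monom 1 d - 1 \<noteq> (0 :: 'k poly)" by (metis coeff_0 zero_neq_one)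
    then have "finite {x :: 'k. poly (monom 1 d - 1) x = 0}" by (rule poly_roots_finite)
    then show ?thesis by (simp add: poly_monom)
  qed
  have fin: "finite \<Gamma>"
  proof (rule finite_subset)
    show "\<Gamma> \<subseteq> {x. x ^ d = 1} \<times> {x. x ^ d = 1}" using prod_unity by (auto simp: \<Gamma>_def)
    show "finite ({x :: 'k. x ^ d = 1} \<times> {x :: 'k. x ^ d = 1})" using unity by simp
  qed
  have one: "(1, 1) \<in> \<Gamma>" unfolding \<Gamma>_def by (auto intro!: exI[of _ "\<lambda>_. 1"])
  have sep: "\<omega> = 1 \<longleftrightarrow> \<theta> = 1" if "(\<omega>, \<theta>) \<in> \<Gamma>" for \<omega> \<theta>
  proof -
    obtain u where u: "\<omega> = (\<Prod>m\<in>R. u m ^ a m)" "\<theta> = (\<Prod>m\<in>R. u m ^ b m)" "\<forall>m\<in>R. u m ^ d = 1"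
      using \<open>(\<omega>, \<theta>) \<in> \<Gamma>\<close> by (auto simp: \<Gamma>_def)
    have "\<theta> = \<omega> ^ k" unfolding u(1,2) by (rule proportional[OF u(3) k])
    moreover have "\<omega> = \<theta> ^ k'" unfolding u(1,2) by (rule proportional[OF u(3) k'])
    ultimately show ?thesis by auto
  qed
  have "\<exists>\<gamma>\<in>\<Gamma>. \<gamma> \<noteq> (1, 1)"
  proof -
    \<comment> \<open>Two distinct primes cannot both be zero in the field, by a Bezout relation;
      this makes the argument independent of the characteristic.\<close>
    have "\<exists>r. prime r \<and> r dvd d \<and> of_nat r \<noteq> (0 :: 'k)"
    proof (rule ccontr)
      assume "\<not> ?thesis"
      then have 0: "of_nat p = (0 :: 'k)" "of_nat q = (0 :: 'k)" using two_primes by blast+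
      have "coprime p q" using two_primes by (simp add: primes_coprime)
      moreover obtain x y where "p * x = q * y + gcd p q"
        using bezout_nat[of p q] two_primes(1) by (auto simp: prime_gt_0_nat)
      ultimately have "of_nat (p * x) = (of_nat (q * y + 1) :: 'k)" by simp
      then show False using 0 by simp
    qed
    then obtain r where r: "prime r" "r dvd d" "of_nat r \<noteq> (0 :: 'k)" by blast
    obtain \<zeta> :: 'k where \<zeta>: "\<zeta> ^ r = 1" "\<zeta> \<noteq> 1" using exists_nontrivial_root_of_unity[OF r(1,3)] by blast
    have \<zeta>d: "\<zeta> ^ d = 1" using r(2) \<zeta>(1) by (auto simp: power_mult)
    \<comment> \<open>Only the parameter of index \<open>l\<close> is nontrivial, so the first entry
      is \<open>\<zeta>^(a l)\<close>; it is not 1, because \<open>\<zeta>\<close> has prime order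
      \<open>r\<close> and \<open>r\<close> does not divide \<open>a l\<close>.\<close>
    let ?u = "\<lambda>m. if m = l then \<zeta> else 1"
    have "(\<Prod>m\<in>R. ?u m ^ a m) = \<zeta> ^ a l"
    proof -
      have "(\<Prod>m\<in>R. ?u m ^ a m) = (\<Prod>m\<in>R. if m = l then \<zeta> ^ a l else 1)"
        by (rule prod.cong) auto
      then show ?thesis using lij by (simp add: R_def)
    qed
    moreover have "\<zeta> ^ a l \<noteq> 1"
    proof
      assume "\<zeta> ^ a l = 1"
      moreover have "coprime r (a l)" using l r(2) by (meson coprime_commute coprime_divisors dvd_refl)
      ultimately show False
        using root_of_unity_coprime_power[OF \<zeta>(1)] \<zeta>(2) prime_gt_0_nat[OF r(1)] by blast
    qed
    moreover have "(\<Prod>m\<in>R. ?u m ^ a m, \<Prod>m\<in>R. ?u m ^ b m) \<in> \<Gamma>"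
      unfolding \<Gamma>_def using \<zeta>d by (intro CollectI exI[of _ ?u]) simp
    ultimately show ?thesis by (metis prod.inject)
  qed
  then obtain \<gamma>0 where other: "\<gamma>0 \<in> \<Gamma>" "\<gamma>0 \<noteq> (1, 1)" by blast

  \<comment> \<open>The pairing is crossed: \<open>s\<close> stands for \<open>x\<^sub>j\<close> and
    \<open>t\<close> for \<open>x\<^sub>i\<close>, since \<open>b j = 0\<close> and
    \<open>a i = 0\<close> leave \<open>y\<^sub>1\<close> depending on \<open>x\<^sub>j\<close> and
    \<open>y\<^sub>2\<close> on \<open>x\<^sub>i\<close>.\<close>
  define X :: "'n + 2 \<Rightarrow> 'k poly4" where
    "X v = (case v of Inl m \<Rightarrow> if m = j then s_var else if m = i then t_var else 1
      | Inr c \<Rightarrow> if c = 1 then y_var else z_var)" for v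
  define pt :: "'k \<Rightarrow> 'k \<Rightarrow> 'k \<Rightarrow> 'k \<Rightarrow> 'k ^ ('n + 2)" where
    "pt y z t s = (\<chi> v. eval4 y z t s (X v))" for y z t s
  have pt: "pt y z t s $ Inl m = (if m = j then s else if m = i then t else 1)"
      "pt y z t s $ Inr 1 = y" "pt y z t s $ Inr 2 = z" for y z t s m
    by (simp_all add: pt_def X_def)
  have subst: "eval4 y z t s (mpoly_subst (\<lambda>c. const4 c) X h) = mpoly_eval h (pt y z t s)" for y z t s h
    unfolding pt_def by (rule hom_mpoly_subst[OF is_ring_hom_eval4]) simp
  have slice: "pt y z t s \<in> toric_variety d a b \<longleftrightarrow>
      (\<exists>(\<omega>, \<theta>)\<in>\<Gamma>. y = \<omega> * s ^ \<alpha> \<and> z = \<theta> * t ^ \<beta>)" for y z t s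
  proof
    assume "pt y z t s \<in> toric_variety d a b"
    then obtain u where u: "\<And>m. pt y z t s $ Inl m = u m ^ d"
        "y = (\<Prod>m\<in>UNIV. u m ^ a m)" "z = (\<Prod>m\<in>UNIV. u m ^ b m)"
      unfolding in_toric_variety_iff pt(2,3) by blast
    have "s = u j ^ d" "t = u i ^ d" using u(1)[of i] u(1)[of j] ij by (auto simp: pt)
    then have "y = (\<Prod>m\<in>R. u m ^ a m) * s ^ \<alpha>" "z = (\<Prod>m\<in>R. u m ^ b m) * t ^ \<beta>"
      using A by (simp_all add: u(2,3) split \<alpha> \<beta> power_mult)
    moreover have "\<forall>m\<in>R. u m ^ d = 1" unfolding u(1)[symmetric] pt by (auto simp: R_def)
    ultimately show "\<exists>(\<omega>, \<theta>)\<in>\<Gamma>. y = \<omega> * s ^ \<alpha> \<and> z = \<theta> * t ^ \<beta>" unfolding \<Gamma>_def by blast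
  next
    assume "\<exists>(\<omega>, \<theta>)\<in>\<Gamma>. y = \<omega> * s ^ \<alpha> \<and> z = \<theta> * t ^ \<beta>"
    then obtain u where u: "\<forall>m\<in>R. u m ^ d = 1" "y = (\<Prod>m\<in>R. u m ^ a m) * s ^ \<alpha>"
        "z = (\<Prod>m\<in>R. u m ^ b m) * t ^ \<beta>" unfolding \<Gamma>_def by blast
    obtain \<sigma> where \<sigma>: "\<sigma> ^ d = s" using nth_root_exists[of d s] d by auto
    obtain \<tau> where \<tau>: "\<tau> ^ d = t" using nth_root_exists[of d t] d by auto
    define w where "w m = (if m = j then \<sigma> else if m = i then \<tau> else u m)" for m
    have wR: "(\<Prod>m\<in>R. w m ^ c m) = (\<Prod>m\<in>R. u m ^ c m)" for c
      by (rule prod.cong) (auto simp: w_def R_def)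
    have "pt y z t s $ Inl m = w m ^ d" for m using u(1) \<sigma> \<tau> by (auto simp: pt w_def R_def)
    moreover have "y = (\<Prod>m\<in>UNIV. w m ^ a m)" "z = (\<Prod>m\<in>UNIV. w m ^ b m)"
      unfolding split wR u(2,3) using A ij by (simp_all add: w_def \<alpha> \<beta> power_mult \<sigma> \<tau>)
    ultimately show "pt y z t s \<in> toric_variety d a b"
      unfolding in_toric_variety_iff pt(2,3) by blast
  qed
  show False
  proof (rule union_of_surfaces_not_two_equations[OF fin one other sep pos])
    fix y z t s :: 'k
    have "mpoly_eval f (pt y z t s) = 0 \<and> mpoly_eval g (pt y z t s) = 0 \<longleftrightarrow> pt y z t s \<in> toric_variety d a b"
      using F(2) fg by auto
    then show "eval4 y z t s (mpoly_subst (\<lambda>c. const4 c) X f) = 0 \<and>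
        eval4 y z t s (mpoly_subst (\<lambda>c. const4 c) X g) = 0 \<longleftrightarrow>
        (\<exists>(\<omega>, \<theta>)\<in>\<Gamma>. y = \<omega> * s ^ \<alpha> \<and> z = \<theta> * t ^ \<beta>)"
      unfolding subst slice .
  qed
qed

theorem corollary2:
  fixes d :: nat and a b :: "'n::finite \<Rightarrow> nat"
    and V :: "('k::alg_closed_field ^ ('n + 2)) set"
  assumes "d > 1"
    and "\<And>i. a i \<noteq> 0 \<or> b i \<noteq> 0"
    and "Gcd (insert d (range a \<union> range b)) = 1"
    and V_def: "V = toric_variety d a b"
    and A: "\<exists>i j. a i = 0 \<and> b i \<noteq> 0 \<and> a j \<noteq> 0 \<and> b j = 0"
    and B_i: "\<And>i. d dvd a i \<longleftrightarrow> d dvd b i"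
    and B_ii: "\<And>i. (\<not> d dvd a i \<longleftrightarrow> gcd d (a i) = 1) \<and> (\<not> d dvd b i \<longleftrightarrow> gcd d (b i) = 1)"
    and C: "(\<exists>k::int. \<forall>i. [int (b i) = k * int (a i)] (mod int d)) \<or>
            (\<exists>k::int. \<forall>i. [int (a i) = k * int (b i)] (mod int d))"
    and D: "\<exists>i. gcd d (a i) = 1"
    and two_primes: "\<exists>p q. prime p \<and> prime q \<and> p \<noteq> q \<and> p dvd d \<and> q dvd d"
  shows "ara V = 3 \<and> \<not> set_theoretic_complete_intersection V"
proof -
  have d0: "d > 0" using \<open>d > 1\<close> by simp
  obtain l where l: "gcd d (a l) = 1" using D by (rule exE)
  then have la: "coprime d (a l)" by (simp add: coprime_iff_gcd_eq_1)
  \<comment> \<open>(B) carries coprimality from one row to the other: prime to \<open>d\<close>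
    means not divisible by \<open>d\<close>, which holds for both entries or neither.\<close>
  have "gcd d (b l) = 1" using B_ii[of l] B_i[of l] l by blast
  then have lb: "coprime d (b l)" by (simp add: coprime_iff_gcd_eq_1)
  obtain k k' :: nat where k: "\<And>i. [b i = k * a i] (mod d)" and k': "\<And>i. [a i = k' * b i] (mod d)"
    using C
  proof
    assume "\<exists>k::int. \<forall>i. [int (b i) = k * int (a i)] (mod int d)"
    then obtain k where k: "\<And>i. [b i = k * a i] (mod d)" using nat_multiple_mod[OF d0, of b _ a] by blast
    then show ?thesis using invert_multiple_mod[of b k a, OF k lb] that by blast
  next
    assume "\<exists>k::int. \<forall>i. [int (a i) = k * int (b i)] (mod int d)"
    then obtain k where k: "\<And>i. [a i = k * b i] (mod d)" using nat_multiple_mod[OF d0, of a _ b] by blast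
    then show ?thesis using invert_multiple_mod[of a k b, OF k la] that by blast
  qed
  obtain i j where ij: "a i = 0" "b i \<noteq> 0" "a j \<noteq> 0" "b j = 0" using A by blast
  have dvd: "d dvd b i" "d dvd a j" using B_i[of i] B_i[of j] ij by simp_all
  obtain p q where pq: "prime p" "prime q" "p \<noteq> q" "p dvd d" "q dvd d" using two_primes by blast
  have la': "coprime (a l) d" and lb': "coprime (b l) d" using la lb by (simp_all add: coprime_commute)
  obtain F where F: "finite F" "card F \<le> 3" "zero_locus F = V"
    using toric_variety_three_equations[where a = a and b = b and d = d, OF d0 assms(2) k la' lb']
    unfolding V_def by blast
  have "ara V \<le> enat (card F)"
    unfolding ara_def by (rule INF_lower) (use F in simp)
  also have "\<dots> \<le> 3" using F(2) by (simp add: numeral_eq_enat)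
  finally have "ara V \<le> 3" .
  moreover have "3 \<le> ara V"
    unfolding ara_def
  proof (rule INF_greatest)
    fix F :: "('n + 2, 'k) mpoly set" assume "F \<in> {F. finite F \<and> zero_locus F = V}"
    then have "card F > 2"
      using toric_variety_not_two_equations[where a = a and b = b and d = d, OF \<open>d > 1\<close> ij dvd k k' la' pq, of F]
      unfolding V_def by blast
    then show "3 \<le> enat (card F)" by (simp add: numeral_eq_enat)
  qed
  ultimately have ara: "ara V = 3" by simp
  \<comment> \<open>With \<open>ara V = 3\<close> known, it remains to see that the codimension is
    not 3; the lower bound on the dimension makes it at most 2.\<close>
  have "zariski_closed V" using F(3) by (auto simp: zariski_closed_def)
  then have "enat CARD('n) \<le> krull_dim V"
    unfolding V_def using krull_dim_toric_variety_ge d0 by blast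
  then have "codim V \<le> 2"
    unfolding codim_def by (cases "krull_dim V") (auto simp: numeral_eq_enat)
  then have "codim V \<noteq> 3" by (auto simp: numeral_eq_enat)
  then show ?thesis unfolding set_theoretic_complete_intersection_def ara by simp
qed

end
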